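(* Let $(S,\Sigma,\mu)$ be a positive measure space, let $X$ be a (real or complex) Banach space whose norm is Fréchet differentiable, and let $1<p<\infty$. Let $f,g\in L^{p}(\mu)$ (scalar-valued functions over the scalar field of $X$) and $x,y\in X$. Then $f\otimes x\perp_{BJ}g\otimes y$ in $L^{p}(\mu)\otimes^{\Delta_p}X$ if and only if either $f\perp_{BJ}g$ in $L^{p}(\mu)$ or $x\perp_{BJ}y$ in $X$.
   Context: For a normed space $E$ over $\mathbb{F}$ ($\mathbb{R}$ or $\mathbb{C}$) and $u,v\in E$, $u$ is Birkhoff-James orthogonal to $v$, written $u\perp_{BJ}v$, if $\|u+\lambda v\|\ge\|u\|$ for all $\lambda\in\mathbb{F}$. $L^{p}(\mu,X)$ is the Lebesgue-Bochner space of (classes modulo a.e. equality of) strongly measurable functions $h:S\to X$ with $\int_S\|h(s)\|^p\,d\mu(s)<\infty$, normed by $\|h\|=\big(\int_S\|h(s)\|^p\,d\mu(s)\big)^{1/p}$. The $\Delta_p$-norm on the algebraic tensor product $L^{p}(\mu)\otimes X$ is $\|u\|_{\Delta_p}=\|\phi(u)\|_{L^{p}(\mu,X)}$, where $\phi:L^{p}(\mu)\otimes X\to L^{p}(\mu,X)$ is the injective linear map determined by $\phi(f\otimes x)=f(\cdot)x$; $L^{p}(\mu)\otimes^{\Delta_p}X$ denotes the completion of $L^{p}(\mu)\otimes X$ in this norm. The norm of $X$ is Fréchet differentiable if for every $0\neq x\in X$ there is a bounded real-linear functional $\varphi:X\to\mathbb{R}$ with $\lim_{h\to0}\frac{|\|x+h\|-\|x\|-\varphi(h)|}{\|h\|}=0$.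 *)

theory Defs
  imports "HOL-Analysis.Analysis" "HOL-Library.Poly_Mapping"
begin

(* L^p(mu) depends on the term mu, so the spaces below cannot be types.  They are records
   over an explicit carrier; the scalar field 'k is used with 'k = real and 'k = complex. *)

record ('k, 'v) vspace =
  carr :: "'v set"
  add :: "'v \<Rightarrow> 'v \<Rightarrow> 'v"
  smul :: "'k \<Rightarrow> 'v \<Rightarrow> 'v"

record ('k, 'v) nspace = "('k, 'v) vspace" +
  nrm :: "'v \<Rightarrow> real"

definition with_norm :: "('k, 'v) vspace \<Rightarrow> ('v \<Rightarrow> real) \<Rightarrow> ('k, 'v) nspace" where
  "with_norm V N = \<lparr>carr = carr V, add = add V, smul = smul V, nrm = N\<rparr>"

(* For an equivalence relation R on the carrier that is compatible with both operations. *)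
definition quot :: "('k, 'v, 'z) vspace_scheme \<Rightarrow> ('v \<times> 'v) set \<Rightarrow> ('k, 'v set) vspace" where
  "quot V R =
    \<lparr>carr = carr V // R,
     add = (\<lambda>A B. \<Union>a\<in>A. \<Union>b\<in>B. R `` {add V a b}),
     smul = (\<lambda>c A. \<Union>a\<in>A. R `` {smul V c a})\<rparr>"

definition BJ_orthogonal :: "('k, 'v) nspace \<Rightarrow> 'v \<Rightarrow> 'v \<Rightarrow> bool" where
  "BJ_orthogonal E u v \<longleftrightarrow> (\<forall>c. nrm E u \<le> nrm E (add E u (smul E c v)))"

(* The type class provides only the real structure of X; its structure over 'k is given by
   a scalar multiplication extending scaleR. *)
locale normed_scaling = vector_space sc
  for sc :: "'k::real_normed_field \<Rightarrow> 'x::real_normed_vector \<Rightarrow> 'x" +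
  assumes scale_of_real: "sc (of_real r) x = r *\<^sub>R x"
    and norm_scale: "norm (sc c x) = norm c * norm x"

definition space_of :: "('k \<Rightarrow> 'x \<Rightarrow> 'x) \<Rightarrow> ('k, 'x::real_normed_vector) nspace" where
  "space_of sc = \<lparr>carr = UNIV, add = (+), smul = sc, nrm = norm\<rparr>"


section \<open>Lebesgue-Bochner spaces\<close>

(* Limits of simple functions at every point of the space; passing to limits almost everywhere
   would give the same classes.  Stronger than borel measurability when the target is not separable. *)
definition strongly_measurable :: "'s measure \<Rightarrow> ('s \<Rightarrow> 'x::topological_space) \<Rightarrow> bool" where
  "strongly_measurable M h \<longleftrightarrow>
    (\<exists>t. (\<forall>n. simple_function M (t n)) \<and> (\<forall>s\<in>space M. (\<lambda>n. t n s) \<longlonglongrightarrow> h s))"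

definition Lp_fun :: "'s measure \<Rightarrow> real \<Rightarrow> ('s \<Rightarrow> 'x::real_normed_vector) set" where
  "Lp_fun M p = {h. strongly_measurable M h \<and> integrable M (\<lambda>s. norm (h s) powr p)}"

definition Lp_eq :: "'s measure \<Rightarrow> real \<Rightarrow> (('s \<Rightarrow> 'x::real_normed_vector) \<times> ('s \<Rightarrow> 'x)) set" where
  "Lp_eq M p = {(f, g). f \<in> Lp_fun M p \<and> g \<in> Lp_fun M p \<and> (AE s in M. f s = g s)}"

definition Lp_fun_norm :: "'s measure \<Rightarrow> real \<Rightarrow> ('s \<Rightarrow> 'x::real_normed_vector) \<Rightarrow> real" where
  "Lp_fun_norm M p h = (LINT s|M. norm (h s) powr p) powr (1 / p)"

definition Lp_fun_space ::
  "('k \<Rightarrow> 'x \<Rightarrow> 'x) \<Rightarrow> 's measure \<Rightarrow> real \<Rightarrow> ('k, 's \<Rightarrow> 'x::real_normed_vector) vspace" where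
  "Lp_fun_space sc M p =
    \<lparr>carr = Lp_fun M p, add = (\<lambda>f g s. f s + g s), smul = (\<lambda>c f s. sc c (f s))\<rparr>"

definition Lp ::
  "('k \<Rightarrow> 'x \<Rightarrow> 'x) \<Rightarrow> 's measure \<Rightarrow> real \<Rightarrow> ('k, ('s \<Rightarrow> 'x::real_normed_vector) set) nspace" where
  "Lp sc M p =
    with_norm (quot (Lp_fun_space sc M p) (Lp_eq M p)) (\<lambda>H. the_elem (Lp_fun_norm M p ` H))"

abbreviation scalar_Lp :: "'s measure \<Rightarrow> real \<Rightarrow> ('k, ('s \<Rightarrow> 'k::real_normed_field) set) nspace" where
  "scalar_Lp \<equiv> Lp (*)"


section \<open>Algebraic tensor products\<close>

(* The free vector space on pairs, modulo the span of the bilinearity relations. *)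

definition formal_smul :: "'k::field \<Rightarrow> ('b \<Rightarrow>\<^sub>0 'k) \<Rightarrow> ('b \<Rightarrow>\<^sub>0 'k)" where
  "formal_smul c = Poly_Mapping.map ((*) c)"

definition formal_space ::
  "('k::field, 'v, 'z) vspace_scheme \<Rightarrow> ('k, 'w, 'y) vspace_scheme \<Rightarrow> ('k, 'v \<times> 'w \<Rightarrow>\<^sub>0 'k) vspace" where
  "formal_space V W =
    \<lparr>carr = {a. Poly_Mapping.keys a \<subseteq> carr V \<times> carr W}, add = (+), smul = formal_smul\<rparr>"

definition bilinearity_relations ::
  "('k::field, 'v, 'z) vspace_scheme \<Rightarrow> ('k, 'w, 'y) vspace_scheme \<Rightarrow> ('v \<times> 'w \<Rightarrow>\<^sub>0 'k) set" where
  "bilinearity_relations V W =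
    (let s = Poly_Mapping.single in
      {s (add V v v', w) 1 - s (v, w) 1 - s (v', w) 1 | v v' w.
        v \<in> carr V \<and> v' \<in> carr V \<and> w \<in> carr W} \<union>
      {s (v, add W w w') 1 - s (v, w) 1 - s (v, w') 1 | v w w'.
        v \<in> carr V \<and> w \<in> carr W \<and> w' \<in> carr W} \<union>
      {s (smul V c v, w) 1 - s (v, w) c | c v w. v \<in> carr V \<and> w \<in> carr W} \<union>
      {s (v, smul W c w) 1 - s (v, w) c | c v w. v \<in> carr V \<and> w \<in> carr W})"

definition tensor_eq ::
  "('k::field, 'v, 'z) vspace_scheme \<Rightarrow> ('k, 'w, 'y) vspace_scheme \<Rightarrow>
    (('v \<times> 'w \<Rightarrow>\<^sub>0 'k) \<times> ('v \<times> 'w \<Rightarrow>\<^sub>0 'k)) set" where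
  "tensor_eq V W =
    {(a, b). a \<in> carr (formal_space V W) \<and> b \<in> carr (formal_space V W) \<and>
      a - b \<in> module.span formal_smul (bilinearity_relations V W)}"

definition tensor_space ::
  "('k::field, 'v, 'z) vspace_scheme \<Rightarrow> ('k, 'w, 'y) vspace_scheme \<Rightarrow>
    ('k, ('v \<times> 'w \<Rightarrow>\<^sub>0 'k) set) vspace" where
  "tensor_space V W = quot (formal_space V W) (tensor_eq V W)"

definition tensor ::
  "('k::field, 'v, 'z) vspace_scheme \<Rightarrow> ('k, 'w, 'y) vspace_scheme \<Rightarrow> 'v \<Rightarrow> 'w \<Rightarrow>
    ('v \<times> 'w \<Rightarrow>\<^sub>0 'k) set" where
  "tensor V W v w = tensor_eq V W `` {Poly_Mapping.single (v, w) 1}"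


section \<open>Completions\<close>

definition ndist :: "('k::ring_1, 'v) nspace \<Rightarrow> 'v \<Rightarrow> 'v \<Rightarrow> real" where
  "ndist E u v = nrm E (add E u (smul E (-1) v))"

(* The completion consists of Cauchy sequences modulo null sequences. *)
definition cauchy_space :: "('k::ring_1, 'v) nspace \<Rightarrow> ('k, nat \<Rightarrow> 'v) vspace" where
  "cauchy_space E =
    \<lparr>carr = {u. (\<forall>n. u n \<in> carr E) \<and> (\<forall>e>0. \<exists>N. \<forall>m\<ge>N. \<forall>n\<ge>N. ndist E (u m) (u n) < e)},
     add = (\<lambda>u v n. add E (u n) (v n)),
     smul = (\<lambda>c u n. smul E c (u n))\<rparr>"

definition cauchy_eq :: "('k::ring_1, 'v) nspace \<Rightarrow> ((nat \<Rightarrow> 'v) \<times> (nat \<Rightarrow> 'v)) set" where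
  "cauchy_eq E =
    {(u, v). u \<in> carr (cauchy_space E) \<and> v \<in> carr (cauchy_space E) \<and>
      (\<lambda>n. ndist E (u n) (v n)) \<longlonglongrightarrow> 0}"

definition completion :: "('k::ring_1, 'v) nspace \<Rightarrow> ('k, (nat \<Rightarrow> 'v) set) nspace" where
  "completion E =
    with_norm (quot (cauchy_space E) (cauchy_eq E))
      (\<lambda>U. the_elem ((\<lambda>u. lim (\<lambda>n. nrm E (u n))) ` U))"

definition to_completion :: "('k::ring_1, 'v) nspace \<Rightarrow> 'v \<Rightarrow> (nat \<Rightarrow> 'v) set" where
  "to_completion E u = cauchy_eq E `` {\<lambda>_. u}"


section \<open>The \<open>\<Delta>\<close> norm on the tensor product\<close>

(* The sum of c f(.) x over the terms c (F, x) of a formal combination, where f represents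
   the class F; the choice of f only matters on a null set. *)
definition phi_formal ::
  "('k::real_normed_field \<Rightarrow> 'x \<Rightarrow> 'x) \<Rightarrow> (('s \<Rightarrow> 'k) set \<times> 'x \<Rightarrow>\<^sub>0 'k) \<Rightarrow> 's \<Rightarrow> 'x::real_normed_vector" where
  "phi_formal sc a =
    (\<lambda>s. \<Sum>(F, x)\<in>Poly_Mapping.keys a.
      sc (Poly_Mapping.lookup a (F, x)) (sc ((SOME f. f \<in> F) s) x))"

definition phi ::
  "('k::real_normed_field \<Rightarrow> 'x \<Rightarrow> 'x) \<Rightarrow> 's measure \<Rightarrow> real \<Rightarrow>
    (('s \<Rightarrow> 'k) set \<times> 'x \<Rightarrow>\<^sub>0 'k) set \<Rightarrow> ('s \<Rightarrow> 'x::real_normed_vector) set" where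
  "phi sc M p A = (\<Union>a\<in>A. Lp_eq M p `` {phi_formal sc a})"

definition Delta_tensor_space ::
  "('k::real_normed_field \<Rightarrow> 'x \<Rightarrow> 'x) \<Rightarrow> 's measure \<Rightarrow> real \<Rightarrow>
    ('k, (('s \<Rightarrow> 'k) set \<times> 'x::real_normed_vector \<Rightarrow>\<^sub>0 'k) set) nspace" where
  "Delta_tensor_space sc M p =
    with_norm (tensor_space (scalar_Lp M p) (space_of sc))
      (\<lambda>A. nrm (Lp sc M p) (phi sc M p A))"

definition Delta_completion ::
  "('k::real_normed_field \<Rightarrow> 'x \<Rightarrow> 'x) \<Rightarrow> 's measure \<Rightarrow> real \<Rightarrow>
    ('k, (nat \<Rightarrow> (('s \<Rightarrow> 'k) set \<times> 'x::real_normed_vector \<Rightarrow>\<^sub>0 'k) set) set) nspace" where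
  "Delta_completion sc M p = completion (Delta_tensor_space sc M p)"

definition Delta_tensor ::
  "('k::real_normed_field \<Rightarrow> 'x \<Rightarrow> 'x) \<Rightarrow> 's measure \<Rightarrow> real \<Rightarrow> ('s \<Rightarrow> 'k) set \<Rightarrow> 'x \<Rightarrow>
    (nat \<Rightarrow> (('s \<Rightarrow> 'k) set \<times> 'x::real_normed_vector \<Rightarrow>\<^sub>0 'k) set) set" where
  "Delta_tensor sc M p F x =
    to_completion (Delta_tensor_space sc M p) (tensor (scalar_Lp M p) (space_of sc) F x)"

end

theory Submission imports Defs begin

text \<open>Differentiability of the norm at \<open>x \<noteq> 0\<close> gives a norm-one functional \<open>\<psi>\<close> with
  \<open>\<psi> x = \<parallel>x\<parallel>\<close> whose real part is the derivative.  Put \<open>k = \<psi> y / \<parallel>x\<parallel>\<close>.  Then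
  \<open>\<parallel>a x + b y\<parallel> \<ge> \<parallel>x\<parallel> |a + b k|\<close> for all scalars, so \<open>f \<bottom> g\<close> implies orthogonality of the
  tensors, while \<open>x \<bottom> y\<close> does so pointwise.  Conversely, the two sides of this inequality at
  \<open>a = 1\<close>, \<open>b = t w\<close> agree to first order in \<open>t\<close>.  If \<open>x \<bottom> y\<close> fails then \<open>k \<noteq> 0\<close>; if moreover
  \<open>\<parallel>f + c g\<parallel> < \<parallel>f\<parallel>\<close>, then by dominated convergence \<open>\<parallel>f x + t (c / k) g y\<parallel>\<^sup>p\<close> equals
  \<open>\<parallel>x\<parallel>\<^sup>p \<parallel>f + t c g\<parallel>\<^sup>p + o(t)\<close>, and convexity makes this smaller than \<open>\<parallel>f x\<parallel>\<^sup>p\<close> for small \<open>t > 0\<close>.\<close>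

section \<open>Quotients\<close>

text \<open>Compatibility with \<open>R\<close> makes all classes in the double union of
  \<open>quot\<close> equal, so the operation can be computed on representatives. This and the next
  lemma serve \<open>L^p\<close>, the tensor product and the completion alike.\<close>

lemma add_quot:
  assumes "equiv (carr V) R"
    and "\<And>a a' b b'. (a, a') \<in> R \<Longrightarrow> (b, b') \<in> R \<Longrightarrow> (add V a b, add V a' b') \<in> R"
    and "a \<in> carr V" "b \<in> carr V"
  shows "add (quot V R) (R `` {a}) (R `` {b}) = R `` {add V a b}"
proof -
  have "congruent2 R R (\<lambda>a b. R `` {add V a b})"
    using assms(2) by (auto simp: congruent2_def intro!: equiv_class_eq[OF assms(1)])
  then show ?thesis
    using UN_equiv_class2[OF assms(1) assms(1) _ assms(3,4)] by (simp add: quot_def)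
qed

lemma smul_quot:
  assumes "equiv (carr V) R"
    and "\<And>a a'. (a, a') \<in> R \<Longrightarrow> (smul V c a, smul V c a') \<in> R"
    and "a \<in> carr V"
  shows "smul (quot V R) c (R `` {a}) = R `` {smul V c a}"
proof -
  have "congruent R (\<lambda>a. R `` {smul V c a})"
    using assms(2) by (auto simp: congruent_def intro!: equiv_class_eq[OF assms(1)])
  then show ?thesis
    using UN_equiv_class[OF assms(1) _ assms(3)] by (simp add: quot_def)
qed

text \<open>A function constant on a class has a singleton image there; this evaluates the norms of
  \<open>Lp\<close> and \<open>completion\<close>, both defined through
  \<open>the_elem\<close>.\<close>

lemma the_elem_image_class:
  assumes "equiv A R" "a \<in> A" "\<And>b. (a, b) \<in> R \<Longrightarrow> N b = N a"
  shows "the_elem (N ` (R `` {a})) = N a"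
proof -
  have "\<And>b. b \<in> R `` {a} \<Longrightarrow> N b = N a"
    by (simp add: assms(3))
  with equiv_class_self[OF assms(1,2)] have "N ` (R `` {a}) = {N a}"
    by blast
  then show ?thesis by simp
qed

section \<open>Functions in \<open>L\<^sup>p\<close>\<close>

text \<open>Applying \<open>h\<close> to approximating simple functions gives simple functions
  again, and the sequential continuity of \<open>h\<close> carries the pointwise limit
  along.\<close>

lemma strongly_measurable_compose2:
  fixes h :: "'x::topological_space \<Rightarrow> 'y::topological_space \<Rightarrow> 'z::topological_space"
  assumes "strongly_measurable M f" "strongly_measurable M g"
    and "\<And>t u a b. t \<longlonglongrightarrow> a \<Longrightarrow> u \<longlonglongrightarrow> b \<Longrightarrow> (\<lambda>n::nat. h (t n) (u n)) \<longlonglongrightarrow> h a b"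
  shows "strongly_measurable M (\<lambda>s. h (f s) (g s))"
proof -
  obtain t u where "\<forall>n. simple_function M (t n)" "\<forall>s\<in>space M. (\<lambda>n. t n s) \<longlonglongrightarrow> f s"
    and "\<forall>n. simple_function M (u n)" "\<forall>s\<in>space M. (\<lambda>n. u n s) \<longlonglongrightarrow> g s"
    using assms(1,2) by (auto simp: strongly_measurable_def)
  then have "\<forall>n. simple_function M (\<lambda>s. h (t n s) (u n s))"
    and "\<forall>s\<in>space M. (\<lambda>n. h (t n s) (u n s)) \<longlonglongrightarrow> h (f s) (g s)"
    by (simp_all add: simple_function_compose2 assms(3))
  then show ?thesis
    unfolding strongly_measurable_def by (intro exI[of _ "\<lambda>n s. h (t n s) (u n s)"]) simp
qed

lemma strongly_measurable_const: "strongly_measurable M (\<lambda>_. a)"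
  unfolding strongly_measurable_def by (intro exI[of _ "\<lambda>_ _. a"]) simp

lemma strongly_measurable_compose:
  fixes h :: "'x::topological_space \<Rightarrow> 'z::topological_space"
  assumes "strongly_measurable M f"
    and "\<And>t a. t \<longlonglongrightarrow> a \<Longrightarrow> (\<lambda>n::nat. h (t n)) \<longlonglongrightarrow> h a"
  shows "strongly_measurable M (\<lambda>s. h (f s))"
proof (rule strongly_measurable_compose2[OF assms(1) assms(1), where h = "\<lambda>x _. h x"])
  fix t u :: "nat \<Rightarrow> 'x" and a b :: 'x
  assume "t \<longlonglongrightarrow> a"
  then show "(\<lambda>n. h (t n)) \<longlonglongrightarrow> h a" by (rule assms(2))
qed

text \<open>Passes from strong measurability to the Borel measurability that integration asks for:
  the norm is a pointwise limit of real simple functions.\<close>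

lemma strongly_measurable_norm:
  fixes h :: "'s \<Rightarrow> 'x::real_normed_vector"
  assumes "strongly_measurable M h"
  shows "(\<lambda>s. norm (h s)) \<in> borel_measurable M"
proof -
  have "strongly_measurable M (\<lambda>s. norm (h s))"
    by (rule strongly_measurable_compose[OF assms]) (rule tendsto_norm)
  then obtain t where t: "\<And>n. simple_function M (t n)"
    "\<And>s. s \<in> space M \<Longrightarrow> (\<lambda>n. t n s) \<longlonglongrightarrow> norm (h s)"
    by (auto simp: strongly_measurable_def)
  show ?thesis
    by (rule borel_measurable_LIMSEQ_real[OF t(2)])
      (auto intro: borel_measurable_simple_function t(1))
qed

text \<open>For positive arguments this is convexity of \<open>powr\<close>; if one argument
  vanishes, it reduces to \<open>u powr p \<le> u\<close> on the unit interval.\<close>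

lemma powr_convex_nonneg:
  fixes x y t p :: real
  assumes "p \<ge> 1" "0 \<le> t" "t \<le> 1" "0 \<le> x" "0 \<le> y"
  shows "((1 - t) * x + t * y) powr p \<le> (1 - t) * x powr p + t * y powr p"
proof -
  have le: "u powr p \<le> u" if "0 \<le> u" "u \<le> 1" for u :: real
    using powr_mono'[of 1 p u] that assms(1) by simp
  consider "x = 0" | "y = 0" | "0 < x" "0 < y" using assms by linarith
  then show ?thesis
  proof cases
    case 1
    then show ?thesis
      using assms mult_right_mono[OF le[of t], of "y powr p"] by (simp add: powr_mult)
  next
    case 2
    then show ?thesis
      using assms mult_right_mono[OF le[of "1 - t"], of "x powr p"] by (simp add: powr_mult)
  next
    case 3
    then show ?thesis
      using convex_onD[OF powr_convex[OF assms(1)], of t x y] assms by simp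
  qed
qed

text \<open>Each summand is at most the maximum. This crude bound gives closure of
  \<open>L^p\<close> under sums and later an integrable majorant.\<close>

lemma powr_add_le:
  fixes a b p :: real
  assumes "p \<ge> 1" "0 \<le> a" "0 \<le> b"
  shows "(a + b) powr p \<le> 2 powr p * (a powr p + b powr p)"
proof -
  have "(a + b) powr p \<le> (2 * max a b) powr p"
    using assms by (intro powr_mono2) auto
  also have "\<dots> = 2 powr p * (max a b) powr p"
    using assms by (simp add: powr_mult)
  also have "\<dots> \<le> 2 powr p * (a powr p + b powr p)"
    by (intro mult_left_mono) (auto simp: max_def)
  finally show ?thesis .
qed

lemma Lp_fun_add:
  assumes "p \<ge> 1" "f \<in> Lp_fun M p" "g \<in> Lp_fun M p"
  shows "(\<lambda>s. f s + g s) \<in> Lp_fun M p"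
proof -
  have sm: "strongly_measurable M (\<lambda>s. f s + g s)"
    by (rule strongly_measurable_compose2[where h = "(+)"])
      (use assms in \<open>simp_all add: Lp_fun_def tendsto_add\<close>)
  have "integrable M (\<lambda>s. 2 powr p * (norm (f s) powr p + norm (g s) powr p))"
    using assms by (auto simp: Lp_fun_def)
  then have "integrable M (\<lambda>s. norm (f s + g s) powr p)"
  proof (rule Bochner_Integration.integrable_bound)
    show "(\<lambda>s. norm (f s + g s) powr p) \<in> borel_measurable M"
      using strongly_measurable_norm[OF sm] by measurable
    show "AE s in M. norm (norm (f s + g s) powr p)
        \<le> norm (2 powr p * (norm (f s) powr p + norm (g s) powr p))"
    proof (rule AE_I2)
      fix s
      have "norm (f s + g s) powr p \<le> (norm (f s) + norm (g s)) powr p"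
        using assms by (intro powr_mono2) (auto intro: norm_triangle_ineq)
      also have "\<dots> \<le> 2 powr p * (norm (f s) powr p + norm (g s) powr p)"
        using assms by (intro powr_add_le) auto
      finally show "norm (norm (f s + g s) powr p)
          \<le> norm (2 powr p * (norm (f s) powr p + norm (g s) powr p))"
        by (simp add: mult_nonneg_nonneg)
    qed
  qed
  with sm show ?thesis by (simp add: Lp_fun_def)
qed

lemma Lp_fun_zero: "(\<lambda>_. 0) \<in> Lp_fun M p"
  by (simp add: Lp_fun_def strongly_measurable_const)

lemma Lp_fun_norm_nonneg: "0 \<le> Lp_fun_norm M p h"
  by (simp add: Lp_fun_norm_def)

lemma Lp_fun_norm_powr:
  assumes "p > 0"
  shows "Lp_fun_norm M p h powr p = (LINT s|M. norm (h s) powr p)"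
  using assms by (simp add: Lp_fun_norm_def powr_powr)

lemma Lp_fun_norm_le_iff:
  assumes "p > 0"
  shows "Lp_fun_norm M p f \<le> Lp_fun_norm M p g \<longleftrightarrow>
    (LINT s|M. norm (f s) powr p) \<le> (LINT s|M. norm (g s) powr p)"
proof
  assume "Lp_fun_norm M p f \<le> Lp_fun_norm M p g"
  then have "Lp_fun_norm M p f powr p \<le> Lp_fun_norm M p g powr p"
    using assms by (intro powr_mono2) (auto simp: Lp_fun_norm_nonneg)
  then show "(LINT s|M. norm (f s) powr p) \<le> (LINT s|M. norm (g s) powr p)"
    by (simp only: Lp_fun_norm_powr[OF assms])
next
  assume "(LINT s|M. norm (f s) powr p) \<le> (LINT s|M. norm (g s) powr p)"
  then show "Lp_fun_norm M p f \<le> Lp_fun_norm M p g"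
    unfolding Lp_fun_norm_def using assms by (intro powr_mono2) auto
qed

lemma Lp_fun_norm_cong:
  assumes "f \<in> Lp_fun M p" "g \<in> Lp_fun M p" "AE s in M. norm (f s) = norm (g s)"
  shows "Lp_fun_norm M p f = Lp_fun_norm M p g"
proof -
  have "(LINT s|M. norm (f s) powr p) = (LINT s|M. norm (g s) powr p)"
  proof (rule integral_cong_AE)
    show "AE s in M. norm (f s) powr p = norm (g s) powr p"
      using assms(3) by eventually_elim simp
  qed (use assms(1,2) in \<open>simp_all add: Lp_fun_def borel_measurable_integrable\<close>)
  then show ?thesis by (simp add: Lp_fun_norm_def)
qed

text \<open>Minkowski's inequality. For \<open>a\<close>, \<open>b\<close> slightly above the two
  norms, \<open>(f + g) / (a + b)\<close> is a convex combination of \<open>f / a\<close> and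
  \<open>g / b\<close>, whose p-th powers have integral at most 1; convexity of the power transfers
  this bound to the sum.\<close>

lemma Lp_fun_norm_triangle:
  assumes p: "p \<ge> 1" and f: "f \<in> Lp_fun M p" and g: "g \<in> Lp_fun M p"
  shows "Lp_fun_norm M p (\<lambda>s. f s + g s) \<le> Lp_fun_norm M p f + Lp_fun_norm M p g"
proof (rule field_le_epsilon)
  fix e :: real assume "e > 0"
  \<comment> \<open>The extra \<open>e / 2\<close> keeps \<open>a\<close> and \<open>b\<close>
    positive even when a norm is 0, so that both can be divided by.\<close>
  define a where "a = Lp_fun_norm M p f + e / 2"
  define b where "b = Lp_fun_norm M p g + e / 2"
  have a: "a > 0" and b: "b > 0"
    using \<open>e > 0\<close> by (simp_all add: a_def b_def Lp_fun_norm_nonneg add_nonneg_pos)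
  have fa: "(LINT s|M. norm (f s) powr p) \<le> a powr p"
    and gb: "(LINT s|M. norm (g s) powr p) \<le> b powr p"
    using p \<open>e > 0\<close> by (auto simp: a_def b_def Lp_fun_norm_nonneg
        simp flip: Lp_fun_norm_powr intro!: powr_mono2)
  have int: "integrable M (\<lambda>s. norm (f s) powr p)" "integrable M (\<lambda>s. norm (g s) powr p)"
    "integrable M (\<lambda>s. norm (f s + g s) powr p)"
    using f g Lp_fun_add[OF p f g] by (auto simp: Lp_fun_def)
  let ?c = "\<lambda>s. (a + b) powr p * (a / (a + b) * (norm (f s) powr p / a powr p)
     + b / (a + b) * (norm (g s) powr p / b powr p))"
  have "(LINT s|M. norm (f s + g s) powr p) \<le> (LINT s|M. ?c s)"
  proof (rule integral_mono[OF int(3)])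
    show "integrable M ?c" using int by auto
    fix s
    let ?t = "b / (a + b)"
    have t: "1 - ?t = a / (a + b)" using a b by (simp add: field_simps)
    have "norm (f s + g s) \<le> (a + b) * ((1 - ?t) * (norm (f s) / a) + ?t * (norm (g s) / b))"
      unfolding t using a b norm_triangle_ineq[of "f s" "g s"] by (simp add: distrib_left)
    then have "norm (f s + g s) powr p
      \<le> ((a + b) * ((1 - ?t) * (norm (f s) / a) + ?t * (norm (g s) / b))) powr p"
      using p by (intro powr_mono2) auto
    also have "\<dots> = (a + b) powr p * ((1 - ?t) * (norm (f s) / a) + ?t * (norm (g s) / b)) powr p"
      using a b by (simp add: powr_mult t)
    also have "\<dots> \<le> (a + b) powr p *
        ((1 - ?t) * (norm (f s) / a) powr p + ?t * (norm (g s) / b) powr p)"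
      using a b p by (intro mult_left_mono powr_convex_nonneg) auto
    finally show "norm (f s + g s) powr p \<le> ?c s"
      using a b by (simp add: t powr_divide)
  qed
  also have "\<dots> = (a + b) powr p * (a / (a + b) * ((LINT s|M. norm (f s) powr p) / a powr p)
     + b / (a + b) * ((LINT s|M. norm (g s) powr p) / b powr p))"
    using int by simp
  also have "\<dots> \<le> (a + b) powr p * (a / (a + b) * 1 + b / (a + b) * 1)"
    using a b fa gb by (intro mult_left_mono add_mono) (auto simp: divide_simps)
  also have "\<dots> = (a + b) powr p"
    using a b by (simp add: add_divide_distrib[symmetric])
  finally have "(LINT s|M. norm (f s + g s) powr p) powr (1 / p) \<le> ((a + b) powr p) powr (1 / p)"
    using p by (intro powr_mono2) auto
  then have "Lp_fun_norm M p (\<lambda>s. f s + g s) \<le> ((a + b) powr p) powr (1 / p)"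
    by (simp only: Lp_fun_norm_def)
  moreover have "((a + b) powr p) powr (1 / p) = a + b"
    using p a b by (simp add: powr_powr)
  ultimately have le: "Lp_fun_norm M p (\<lambda>s. f s + g s) \<le> a + b"
    by (rule ord_le_eq_trans)
  have sum: "a + b = Lp_fun_norm M p f + Lp_fun_norm M p g + e"
    unfolding a_def b_def by (rule trans[OF add.assoc]) (simp only: add_ac field_sum_of_halves)
  show "Lp_fun_norm M p (\<lambda>s. f s + g s) \<le> Lp_fun_norm M p f + Lp_fun_norm M p g + e"
    by (rule le[unfolded sum])
qed

lemma Lp_eq_iff:
  "(f, g) \<in> Lp_eq M p \<longleftrightarrow> f \<in> Lp_fun M p \<and> g \<in> Lp_fun M p \<and> (AE s in M. f s = g s)"
  by (simp add: Lp_eq_def)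

lemma equiv_Lp_eq: "equiv (Lp_fun M p) (Lp_eq M p)"
proof (rule equivI)
  show "trans (Lp_eq M p)"
  proof (rule transI)
    fix f g h assume "(f, g) \<in> Lp_eq M p" "(g, h) \<in> Lp_eq M p"
    moreover from this have "AE s in M. f s = h s"
      unfolding Lp_eq_iff by (auto elim: eventually_elim2)
    ultimately show "(f, h) \<in> Lp_eq M p" by (simp add: Lp_eq_iff)
  qed
  show "sym (Lp_eq M p)"
    by (rule symI) (simp add: Lp_eq_iff eq_commute)
qed (auto simp: Lp_eq_iff refl_on_def)

lemma Lp_class_eq_iff:
  assumes "f \<in> Lp_fun M p" "g \<in> Lp_fun M p"
  shows "Lp_eq M p `` {f} = Lp_eq M p `` {g} \<longleftrightarrow> (AE s in M. f s = g s)"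
  using assms by (simp add: eq_equiv_class_iff[OF equiv_Lp_eq assms] Lp_eq_iff)

lemma Lp_eq_add:
  assumes "p \<ge> 1" "(f, f') \<in> Lp_eq M p" "(g, g') \<in> Lp_eq M p"
  shows "(\<lambda>s. f s + g s, \<lambda>s. f' s + g' s) \<in> Lp_eq M p"
proof -
  have "AE s in M. f s + g s = f' s + g' s"
    using assms(2,3) unfolding Lp_eq_iff by (auto elim: eventually_elim2)
  then show ?thesis using assms by (simp add: Lp_eq_iff Lp_fun_add)
qed

section \<open>Operations, norm and orthogonality of \<open>L^p\<close> classes through
  representatives\<close>

context normed_scaling
begin

text \<open>Boundedness yields the continuity by which strong measurability passes to scalar
  multiples; the next lemma does the same for elementary tensors.\<close>

lemma bounded_linear_sc: "bounded_linear (sc c)"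
proof (rule bounded_linear_intro[where K = "norm c"])
  fix x y and r :: real
  show "sc c (x + y) = sc c x + sc c y" by (simp add: scale_right_distrib)
  have "sc c (sc (of_real r) x) = sc (of_real r) (sc c x)" by (simp add: mult.commute)
  then show "sc c (r *\<^sub>R x) = r *\<^sub>R sc c x" by (simp only: scale_of_real)
qed (simp add: norm_scale mult.commute)

lemma bounded_linear_sc_left: "bounded_linear (\<lambda>c. sc c x)"
proof (rule bounded_linear_intro[where K = "norm x"])
  fix a b and r :: real
  show "sc (a + b) x = sc a x + sc b x" by (simp add: scale_left_distrib)
  have "sc (of_real r * a) x = sc (of_real r) (sc a x)" by simp
  then show "sc (r *\<^sub>R a) x = r *\<^sub>R sc a x"
    by (simp only: scale_of_real scaleR_conv_of_real)
qed (simp add: norm_scale)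

lemma Lp_fun_smul:
  assumes "h \<in> Lp_fun M p"
  shows "(\<lambda>s. sc c (h s)) \<in> Lp_fun M p"
proof -
  have "strongly_measurable M (\<lambda>s. sc c (h s))"
    by (rule strongly_measurable_compose[where h = "sc c"])
      (use assms in \<open>simp_all add: Lp_fun_def bounded_linear.tendsto[OF bounded_linear_sc]\<close>)
  then show ?thesis
    using assms by (auto simp: Lp_fun_def norm_scale powr_mult)
qed

lemma Lp_fun_tensor:
  assumes "f \<in> Lp_fun M p"
  shows "(\<lambda>s. sc (f s) x) \<in> Lp_fun M p"
proof -
  have "strongly_measurable M (\<lambda>s. sc (f s) x)"
    by (rule strongly_measurable_compose[where h = "\<lambda>c. sc c x"])
      (use assms in \<open>simp_all add: Lp_fun_def bounded_linear.tendsto[OF bounded_linear_sc_left]\<close>)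
  then show ?thesis
    using assms by (auto simp: Lp_fun_def norm_scale powr_mult)
qed

lemma Lp_fun_norm_smul:
  assumes "p > 0"
  shows "Lp_fun_norm M p (\<lambda>s. sc c (h s)) = norm c * Lp_fun_norm M p h"
  using assms by (simp add: Lp_fun_norm_def norm_scale powr_mult powr_powr)

lemma Lp_fun_diff:
  fixes f g :: "'s \<Rightarrow> 'x"
  assumes "p \<ge> 1" "f \<in> Lp_fun M p" "g \<in> Lp_fun M p"
  shows "(\<lambda>s. f s - g s) \<in> Lp_fun M p"
  using Lp_fun_add[OF assms(1,2) Lp_fun_smul[OF assms(3), of "-1"]] by simp

lemma carr_Lp: "carr (Lp sc M p) = Lp_fun M p // Lp_eq M p"
  by (simp add: Lp_def with_norm_def quot_def Lp_fun_space_def)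

lemma Lp_eq_smul:
  assumes "(f, f') \<in> Lp_eq M p"
  shows "(\<lambda>s. sc c (f s), \<lambda>s. sc c (f' s)) \<in> Lp_eq M p"
proof -
  have "AE s in M. sc c (f s) = sc c (f' s)"
    using assms unfolding Lp_eq_iff by (auto elim: eventually_mono)
  then show ?thesis using assms by (simp add: Lp_eq_iff Lp_fun_smul)
qed

lemma Lp_simps:
  "add (Lp sc M p) = add (quot (Lp_fun_space sc M p) (Lp_eq M p))"
  "smul (Lp sc M p) = smul (quot (Lp_fun_space sc M p) (Lp_eq M p))"
  "nrm (Lp sc M p) = (\<lambda>H. the_elem (Lp_fun_norm M p ` H))"
  "carr (Lp_fun_space sc M p) = Lp_fun M p"
  "add (Lp_fun_space sc M p) = (\<lambda>f g s. f s + g s)"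
  "smul (Lp_fun_space sc M p) = (\<lambda>c f s. sc c (f s))"
  by (simp_all add: Lp_def with_norm_def Lp_fun_space_def)

lemma Lp_add:
  assumes "p \<ge> 1" "f \<in> Lp_fun M p" "g \<in> Lp_fun M p"
  shows "add (Lp sc M p) (Lp_eq M p `` {f}) (Lp_eq M p `` {g}) = Lp_eq M p `` {\<lambda>s. f s + g s}"
  using add_quot[of "Lp_fun_space sc M p" "Lp_eq M p" f g] assms
  by (simp add: Lp_simps equiv_Lp_eq Lp_eq_add)

lemma Lp_smul:
  assumes "f \<in> Lp_fun M p"
  shows "smul (Lp sc M p) c (Lp_eq M p `` {f}) = Lp_eq M p `` {\<lambda>s. sc c (f s)}"
  using smul_quot[of "Lp_fun_space sc M p" "Lp_eq M p" c f] assms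
  by (simp add: Lp_simps equiv_Lp_eq Lp_eq_smul)

lemma Lp_nrm:
  assumes "f \<in> Lp_fun M p"
  shows "nrm (Lp sc M p) (Lp_eq M p `` {f}) = Lp_fun_norm M p f"
  unfolding Lp_simps
proof (rule the_elem_image_class[OF equiv_Lp_eq assms])
  fix g assume "(f, g) \<in> Lp_eq M p"
  then show "Lp_fun_norm M p g = Lp_fun_norm M p f"
    by (intro Lp_fun_norm_cong) (auto simp: Lp_eq_iff elim: eventually_mono)
qed

lemma BJ_orthogonal_Lp:
  assumes "p \<ge> 1" "f \<in> Lp_fun M p" "g \<in> Lp_fun M p"
  shows "BJ_orthogonal (Lp sc M p) (Lp_eq M p `` {f}) (Lp_eq M p `` {g}) \<longleftrightarrow>
    (\<forall>c. Lp_fun_norm M p f \<le> Lp_fun_norm M p (\<lambda>s. f s + sc c (g s)))"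
  using assms by (simp add: BJ_orthogonal_def Lp_add Lp_smul Lp_nrm Lp_fun_add Lp_fun_smul)

end

section \<open>Completions\<close>

text \<open>The laws of a pseudometric, its compatibility with both operations, and a Lipschitz
  bound for the norm: what lets operations and norm descend to Cauchy sequences modulo null
  sequences. In this form each law can be checked on representatives.\<close>

locale normed_ops =
  fixes E :: "('k::real_normed_field, 'v) nspace"
  assumes add_closed: "u \<in> carr E \<Longrightarrow> v \<in> carr E \<Longrightarrow> add E u v \<in> carr E"
    and smul_closed: "u \<in> carr E \<Longrightarrow> smul E c u \<in> carr E"
    and dist_nonneg: "u \<in> carr E \<Longrightarrow> v \<in> carr E \<Longrightarrow> 0 \<le> ndist E u v"
    and dist_self: "u \<in> carr E \<Longrightarrow> ndist E u u = 0"
    and dist_commute: "u \<in> carr E \<Longrightarrow> v \<in> carr E \<Longrightarrow> ndist E u v = ndist E v u"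
    and dist_triangle: "u \<in> carr E \<Longrightarrow> v \<in> carr E \<Longrightarrow> w \<in> carr E \<Longrightarrow>
      ndist E u w \<le> ndist E u v + ndist E v w"
    and dist_add: "u \<in> carr E \<Longrightarrow> v \<in> carr E \<Longrightarrow> u' \<in> carr E \<Longrightarrow> v' \<in> carr E \<Longrightarrow>
      ndist E (add E u v) (add E u' v') \<le> ndist E u u' + ndist E v v'"
    and dist_smul: "u \<in> carr E \<Longrightarrow> v \<in> carr E \<Longrightarrow>
      ndist E (smul E c u) (smul E c v) \<le> norm c * ndist E u v"
    and nrm_le: "u \<in> carr E \<Longrightarrow> v \<in> carr E \<Longrightarrow> nrm E u \<le> nrm E v + ndist E u v"
begin

lemma carr_cauchy_space:
  "u \<in> carr (cauchy_space E) \<longleftrightarrow>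
    (\<forall>n. u n \<in> carr E) \<and> (\<forall>e>0. \<exists>N. \<forall>m\<ge>N. \<forall>n\<ge>N. ndist E (u m) (u n) < e)"
  by (simp add: cauchy_space_def)

lemma cauchy_space_ops:
  "add (cauchy_space E) u v = (\<lambda>n. add E (u n) (v n))"
  "smul (cauchy_space E) c u = (\<lambda>n. smul E c (u n))"
  by (simp_all add: cauchy_space_def)

lemma cauchy_space_add:
  assumes u: "u \<in> carr (cauchy_space E)" and v: "v \<in> carr (cauchy_space E)"
  shows "(\<lambda>n. add E (u n) (v n)) \<in> carr (cauchy_space E)"
  unfolding carr_cauchy_space
proof (intro conjI allI impI)
  show "add E (u n) (v n) \<in> carr E" for n
    using u v by (simp add: carr_cauchy_space add_closed)
  fix e :: real assume "e > 0"
  then have "e / 2 > 0" by simp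
  with u v obtain K L where K: "\<And>m n. m \<ge> K \<Longrightarrow> n \<ge> K \<Longrightarrow> ndist E (u m) (u n) < e / 2"
    and L: "\<And>m n. m \<ge> L \<Longrightarrow> n \<ge> L \<Longrightarrow> ndist E (v m) (v n) < e / 2"
    unfolding carr_cauchy_space by meson
  show "\<exists>N. \<forall>m\<ge>N. \<forall>n\<ge>N. ndist E (add E (u m) (v m)) (add E (u n) (v n)) < e"
  proof (intro exI[of _ "max K L"] allI impI)
    fix m n assume "max K L \<le> m" "max K L \<le> n"
    then have "ndist E (u m) (u n) < e / 2" "ndist E (v m) (v n) < e / 2"
      by (auto intro!: K L simp del: less_divide_eq_numeral1)
    moreover have "ndist E (add E (u m) (v m)) (add E (u n) (v n))
        \<le> ndist E (u m) (u n) + ndist E (v m) (v n)"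
      using u v by (intro dist_add) (simp_all add: carr_cauchy_space)
    ultimately show "ndist E (add E (u m) (v m)) (add E (u n) (v n)) < e"
      by linarith
  qed
qed

lemma cauchy_space_smul:
  assumes u: "u \<in> carr (cauchy_space E)"
  shows "(\<lambda>n. smul E c (u n)) \<in> carr (cauchy_space E)"
  unfolding carr_cauchy_space
proof (intro conjI allI impI)
  show "smul E c (u n) \<in> carr E" for n
    using u by (simp add: carr_cauchy_space smul_closed)
  fix e :: real assume e: "e > 0"
  \<comment> \<open>The added 1 keeps the divisor positive also for \<open>c = 0\<close>.\<close>
  have c: "norm c + 1 > 0" by (simp add: add_nonneg_pos)
  with e have "e / (norm c + 1) > 0" by simp
  with u obtain K where K: "\<And>m n. m \<ge> K \<Longrightarrow> n \<ge> K \<Longrightarrow> ndist E (u m) (u n) < e / (norm c + 1)"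
    unfolding carr_cauchy_space by meson
  show "\<exists>N. \<forall>m\<ge>N. \<forall>n\<ge>N. ndist E (smul E c (u m)) (smul E c (u n)) < e"
  proof (intro exI[of _ K] allI impI)
    fix m n assume mn: "K \<le> m" "K \<le> n"
    have uc: "u m \<in> carr E" "u n \<in> carr E"
      using u by (simp_all add: carr_cauchy_space)
    have "ndist E (smul E c (u m)) (smul E c (u n)) \<le> norm c * ndist E (u m) (u n)"
      by (rule dist_smul[OF uc])
    also have "\<dots> \<le> (norm c + 1) * ndist E (u m) (u n)"
      by (rule mult_right_mono[OF _ dist_nonneg[OF uc]]) simp
    also have "\<dots> < e"
      using K[OF mn] c by (simp add: pos_less_divide_eq mult.commute)
    finally show "ndist E (smul E c (u m)) (smul E c (u n)) < e" .
  qed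
qed

lemma const_in_cauchy_space: "u \<in> carr E \<Longrightarrow> (\<lambda>_. u) \<in> carr (cauchy_space E)"
  by (simp add: carr_cauchy_space dist_self)

lemma cauchy_eq_iff:
  "(u, v) \<in> cauchy_eq E \<longleftrightarrow> u \<in> carr (cauchy_space E) \<and> v \<in> carr (cauchy_space E) \<and>
    (\<lambda>n. ndist E (u n) (v n)) \<longlonglongrightarrow> 0"
  by (simp add: cauchy_eq_def)

lemma tendsto_zero_ndist_le:
  assumes "\<And>n. u n \<in> carr E" "\<And>n. v n \<in> carr E" "\<And>n. ndist E (u n) (v n) \<le> b n" "b \<longlonglongrightarrow> 0"
  shows "(\<lambda>n. ndist E (u n) (v n)) \<longlonglongrightarrow> 0"
  by (rule tendsto_sandwich[OF _ _ tendsto_const assms(4)]) (simp_all add: assms dist_nonneg)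

lemma equiv_cauchy_eq: "equiv (carr (cauchy_space E)) (cauchy_eq E)"
proof (rule equivI)
  show "cauchy_eq E \<subseteq> carr (cauchy_space E) \<times> carr (cauchy_space E)"
    by (auto simp: cauchy_eq_iff)
  show "refl_on (carr (cauchy_space E)) (cauchy_eq E)"
    by (rule refl_onI) (simp add: cauchy_eq_iff, simp add: carr_cauchy_space dist_self)
  show "sym (cauchy_eq E)"
  proof (rule symI)
    fix u v assume uv: "(u, v) \<in> cauchy_eq E"
    then have "ndist E (v n) (u n) = ndist E (u n) (v n)" for n
      by (intro dist_commute) (simp_all add: cauchy_eq_iff carr_cauchy_space)
    with uv show "(v, u) \<in> cauchy_eq E" by (simp add: cauchy_eq_iff)
  qed
  show "trans (cauchy_eq E)"
  proof (rule transI)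
    fix u v w assume uv: "(u, v) \<in> cauchy_eq E" and vw: "(v, w) \<in> cauchy_eq E"
    have "(\<lambda>n. ndist E (u n) (w n)) \<longlonglongrightarrow> 0"
    proof (rule tendsto_zero_ndist_le)
      show "ndist E (u n) (w n) \<le> ndist E (u n) (v n) + ndist E (v n) (w n)" for n
        using uv vw by (intro dist_triangle) (simp_all add: cauchy_eq_iff carr_cauchy_space)
      show "(\<lambda>n. ndist E (u n) (v n) + ndist E (v n) (w n)) \<longlonglongrightarrow> 0"
        using uv vw by (intro tendsto_add_zero) (simp_all add: cauchy_eq_iff)
    qed (use uv vw in \<open>simp_all add: cauchy_eq_iff carr_cauchy_space\<close>)
    with uv vw show "(u, w) \<in> cauchy_eq E" by (simp add: cauchy_eq_iff)
  qed
qed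

lemma cauchy_eq_add:
  assumes u: "(u, u') \<in> cauchy_eq E" and v: "(v, v') \<in> cauchy_eq E"
  shows "((\<lambda>n. add E (u n) (v n)), (\<lambda>n. add E (u' n) (v' n))) \<in> cauchy_eq E"
proof -
  have "(\<lambda>n. ndist E (add E (u n) (v n)) (add E (u' n) (v' n))) \<longlonglongrightarrow> 0"
  proof (rule tendsto_zero_ndist_le)
    show "ndist E (add E (u n) (v n)) (add E (u' n) (v' n))
        \<le> ndist E (u n) (u' n) + ndist E (v n) (v' n)" for n
      using u v by (intro dist_add) (simp_all add: cauchy_eq_iff carr_cauchy_space)
    show "(\<lambda>n. ndist E (u n) (u' n) + ndist E (v n) (v' n)) \<longlonglongrightarrow> 0"
      using u v by (intro tendsto_add_zero) (simp_all add: cauchy_eq_iff)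
  qed (use u v in \<open>simp_all add: cauchy_eq_iff carr_cauchy_space add_closed\<close>)
  with u v show ?thesis by (simp add: cauchy_eq_iff cauchy_space_add)
qed

lemma cauchy_eq_smul:
  assumes u: "(u, u') \<in> cauchy_eq E"
  shows "((\<lambda>n. smul E c (u n)), (\<lambda>n. smul E c (u' n))) \<in> cauchy_eq E"
proof -
  have "(\<lambda>n. ndist E (smul E c (u n)) (smul E c (u' n))) \<longlonglongrightarrow> 0"
  proof (rule tendsto_zero_ndist_le)
    show "ndist E (smul E c (u n)) (smul E c (u' n)) \<le> norm c * ndist E (u n) (u' n)" for n
      using u by (intro dist_smul) (simp_all add: cauchy_eq_iff carr_cauchy_space)
    show "(\<lambda>n. norm c * ndist E (u n) (u' n)) \<longlonglongrightarrow> 0"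
      using u by (intro tendsto_mult_right_zero) (simp_all add: cauchy_eq_iff)
  qed (use u in \<open>simp_all add: cauchy_eq_iff carr_cauchy_space smul_closed\<close>)
  with u show ?thesis by (simp add: cauchy_eq_iff cauchy_space_smul)
qed

lemma completion_simps:
  "add (completion E) = add (quot (cauchy_space E) (cauchy_eq E))"
  "smul (completion E) = smul (quot (cauchy_space E) (cauchy_eq E))"
  "nrm (completion E) = (\<lambda>U. the_elem ((\<lambda>u. lim (\<lambda>n. nrm E (u n))) ` U))"
  by (simp_all add: completion_def with_norm_def)

lemma completion_add:
  assumes "u \<in> carr E" "v \<in> carr E"
  shows "add (completion E) (to_completion E u) (to_completion E v) = to_completion E (add E u v)"
  using add_quot[OF equiv_cauchy_eq, of "\<lambda>_. u" "\<lambda>_. v"] assms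
  by (simp add: completion_simps to_completion_def cauchy_space_ops cauchy_eq_add
      const_in_cauchy_space)

lemma completion_smul:
  assumes "u \<in> carr E"
  shows "smul (completion E) c (to_completion E u) = to_completion E (smul E c u)"
  using smul_quot[OF equiv_cauchy_eq, of c "\<lambda>_. u"] assms
  by (simp add: completion_simps to_completion_def cauchy_space_ops cauchy_eq_smul
      const_in_cauchy_space)

text \<open>By \<open>nrm_le\<close> in both directions the norms of \<open>v n\<close> and
  \<open>u\<close> differ by at most their distance, so every sequence in the class of the constant
  sequence has norms tending to \<open>nrm E u\<close>.\<close>

lemma completion_nrm:
  assumes u: "u \<in> carr E"
  shows "nrm (completion E) (to_completion E u) = nrm E u"
proof -
  have lim: "lim (\<lambda>n. nrm E (v n)) = nrm E u" if "((\<lambda>_. u), v) \<in> cauchy_eq E" for v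
  proof -
    have v: "v n \<in> carr E" for n
      using that by (simp add: cauchy_eq_iff carr_cauchy_space)
    have bound: "\<bar>nrm E (v n) - nrm E u\<bar> \<le> ndist E u (v n)" for n
      using nrm_le[OF u v[of n]] nrm_le[OF v[of n] u] dist_commute[OF u v[of n]] by linarith
    have "(\<lambda>n. nrm E (v n) - nrm E u) \<longlonglongrightarrow> 0"
      by (rule Lim_null_comparison[where g = "\<lambda>n. ndist E u (v n)", OF always_eventually])
        (use that bound in \<open>simp_all add: cauchy_eq_iff\<close>)
    then show ?thesis by (rule limI[OF LIM_zero_cancel])
  qed
  show ?thesis
    unfolding completion_simps to_completion_def
    using the_elem_image_class[OF equiv_cauchy_eq const_in_cauchy_space[OF u],
        where N = "\<lambda>v. lim (\<lambda>n. nrm E (v n))"] lim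
    by simp
qed

text \<open>The embedding preserves sums, multiples and norms, and orthogonality quantifies over
  scalars only, so points added by completing never enter.\<close>

lemma BJ_orthogonal_completion:
  assumes "u \<in> carr E" "v \<in> carr E"
  shows "BJ_orthogonal (completion E) (to_completion E u) (to_completion E v) \<longleftrightarrow>
    BJ_orthogonal E u v"
  using assms
  by (simp add: BJ_orthogonal_def completion_add completion_smul completion_nrm
      add_closed smul_closed)

end

section \<open>The tensor product\<close>

text \<open>Regards the field as a space over itself, so that the vector-valued lemmas apply to
  \<open>scalar_Lp\<close> as well.\<close>

lemma normed_scaling_times: "normed_scaling ((*) :: 'k::real_normed_field \<Rightarrow> 'k \<Rightarrow> 'k)"
  by unfold_locales (simp_all add: algebra_simps scaleR_conv_of_real norm_mult)

lemma normed_scaling_scaleR: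
  "normed_scaling ((*\<^sub>R) :: real \<Rightarrow> 'x::real_normed_vector \<Rightarrow> 'x)"
  by unfold_locales (simp_all add: algebra_simps)

lemma lookup_formal_smul [simp]:
  "Poly_Mapping.lookup (formal_smul c a) k = c * Poly_Mapping.lookup a k"
  by (simp add: formal_smul_def Poly_Mapping.map.rep_eq when_def)

interpretation formal: vector_space "formal_smul :: 'k::field \<Rightarrow> ('b \<Rightarrow>\<^sub>0 'k) \<Rightarrow> ('b \<Rightarrow>\<^sub>0 'k)"
  by unfold_locales (rule poly_mapping_eqI, simp add: lookup_add algebra_simps)+

lemma keys_formal_smul: "Poly_Mapping.keys (formal_smul c a) \<subseteq> Poly_Mapping.keys a"
  by (auto simp: in_keys_iff)

lemma formal_space_simps:
  "a \<in> carr (formal_space V W) \<longleftrightarrow> Poly_Mapping.keys a \<subseteq> carr V \<times> carr W"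
  "add (formal_space V W) = (+)" "smul (formal_space V W) = formal_smul"
  by (simp_all add: formal_space_def)

lemma formal_space_add:
  assumes "a \<in> carr (formal_space V W)" "b \<in> carr (formal_space V W)"
  shows "a + b \<in> carr (formal_space V W)"
  using assms Poly_Mapping.keys_add[of a b] unfolding formal_space_simps by blast

lemma formal_space_smul:
  assumes "a \<in> carr (formal_space V W)"
  shows "formal_smul c a \<in> carr (formal_space V W)"
  using assms keys_formal_smul[of c a] unfolding formal_space_simps by blast

lemma formal_space_single:
  assumes "v \<in> carr V" "w \<in> carr W"
  shows "Poly_Mapping.single (v, w) c \<in> carr (formal_space V W)"
  using assms by (simp add: formal_space_simps)

lemma tensor_eq_iff:
  "(a, b) \<in> tensor_eq V W \<longleftrightarrow>
    a \<in> carr (formal_space V W) \<and> b \<in> carr (formal_space V W) \<and>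
    a - b \<in> formal.span (bilinearity_relations V W)"
  by (simp add: tensor_eq_def)

lemma equiv_tensor_eq: "equiv (carr (formal_space V W)) (tensor_eq V W)"
proof (rule equivI)
  show "tensor_eq V W \<subseteq> carr (formal_space V W) \<times> carr (formal_space V W)"
    by (auto simp: tensor_eq_iff)
  show "refl_on (carr (formal_space V W)) (tensor_eq V W)"
    by (rule refl_onI) (simp add: tensor_eq_iff formal.span_zero)
  show "sym (tensor_eq V W)"
  proof (rule symI)
    fix a b assume "(a, b) \<in> tensor_eq V W"
    then show "(b, a) \<in> tensor_eq V W"
      using formal.span_neg[of "a - b"] by (simp add: tensor_eq_iff)
  qed
  show "trans (tensor_eq V W)"
  proof (rule transI)
    fix a b c assume "(a, b) \<in> tensor_eq V W" "(b, c) \<in> tensor_eq V W"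
    then show "(a, c) \<in> tensor_eq V W"
      using formal.span_add[of "a - b" _ "b - c"] by (simp add: tensor_eq_iff)
  qed
qed

lemma tensor_eq_add:
  assumes "(a, a') \<in> tensor_eq V W" "(b, b') \<in> tensor_eq V W"
  shows "(a + b, a' + b') \<in> tensor_eq V W"
  using assms formal.span_add[of "a - a'" _ "b - b'"]
  by (simp add: tensor_eq_iff formal_space_add algebra_simps)

lemma tensor_eq_smul:
  assumes "(a, a') \<in> tensor_eq V W"
  shows "(formal_smul c a, formal_smul c a') \<in> tensor_eq V W"
  using assms formal.span_scale[of "a - a'" _ c]
  by (simp add: tensor_eq_iff formal_space_smul formal.scale_right_diff_distrib)

section \<open>The canonical map on formal combinations\<close>

context normed_scaling
begin

interpretation scalar: normed_scaling "(*) :: 'k \<Rightarrow> 'k \<Rightarrow> 'k"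
  by (rule normed_scaling_times)

abbreviation rep :: "('s \<Rightarrow> 'k) set \<Rightarrow> 's \<Rightarrow> 'k" where
  "rep F \<equiv> SOME f. f \<in> F"

text \<open>Classes in the carrier are nonempty, so the choice made inside \<open>phi_formal\<close>
  really picks a member.\<close>

lemma rep_class:
  assumes "F \<in> carr (scalar_Lp M p :: ('k, ('s \<Rightarrow> 'k) set) nspace)"
  shows "rep F \<in> Lp_fun M p" "Lp_eq M p `` {rep F} = F"
proof -
  obtain f where f: "f \<in> Lp_fun M p" "F = Lp_eq M p `` {f}"
    using assms unfolding scalar.carr_Lp by (auto elim: quotientE)
  have "f \<in> F"
    using equiv_class_self[OF equiv_Lp_eq f(1)] f(2) by simp
  then have "rep F \<in> F" by (rule someI[of "\<lambda>f. f \<in> F"])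
  then have "(f, rep F) \<in> Lp_eq M p" by (simp add: f(2))
  then show "rep F \<in> Lp_fun M p" "Lp_eq M p `` {rep F} = F"
    using equiv_class_eq[OF equiv_Lp_eq] by (auto simp: f(2) Lp_eq_iff)
qed

lemma AE_rep_class:
  assumes "f \<in> Lp_fun M p"
  shows "AE s in M. rep (Lp_eq M p `` {f}) s = f s"
proof -
  have F: "Lp_eq M p `` {f} \<in> carr (scalar_Lp M p)"
    using assms by (simp add: scalar.carr_Lp quotientI)
  show ?thesis
    using rep_class[OF F] Lp_class_eq_iff[OF rep_class(1)[OF F] assms] by simp
qed

text \<open>Indices outside the support contribute 0. Summing over a common larger set makes
  linearity a termwise identity.\<close>

lemma phi_formal_eq_sum:
  assumes "finite K" "Poly_Mapping.keys a \<subseteq> K"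
  shows "phi_formal sc a s = (\<Sum>(F, x)\<in>K. sc (Poly_Mapping.lookup a (F, x)) (sc (rep F s) x))"
  unfolding phi_formal_def
  by (rule sum.mono_neutral_left) (use assms in \<open>auto simp: in_keys_iff\<close>)

lemma phi_formal_add: "phi_formal sc (a + b) = (\<lambda>s. phi_formal sc a s + phi_formal sc b s)"
proof
  fix s
  let ?K = "Poly_Mapping.keys a \<union> Poly_Mapping.keys b"
  show "phi_formal sc (a + b) s = phi_formal sc a s + phi_formal sc b s"
    using Poly_Mapping.keys_add[of a b]
    by (simp add: phi_formal_eq_sum[of ?K] lookup_add scale_left_distrib distrib_right case_prod_beta
        flip: sum.distrib)
qed

lemma phi_formal_smul: "phi_formal sc (formal_smul c a) = (\<lambda>s. sc c (phi_formal sc a s))"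
proof
  fix s
  show "phi_formal sc (formal_smul c a) s = sc c (phi_formal sc a s)"
    using keys_formal_smul[of c a]
    by (simp add: phi_formal_eq_sum[of "Poly_Mapping.keys a"] scale_sum_right mult.assoc case_prod_beta)
qed

lemma phi_formal_diff: "phi_formal sc (a - b) = (\<lambda>s. phi_formal sc a s - phi_formal sc b s)"
proof -
  have "formal_smul (-1) b = - b" by (rule poly_mapping_eqI) simp
  then have "a - b = a + formal_smul (-1) b" by simp
  then show ?thesis by (simp only: phi_formal_add phi_formal_smul) simp
qed

lemma phi_formal_single:
  "phi_formal sc (Poly_Mapping.single (F, x) c) = (\<lambda>s. sc c (sc (rep F s) x))"
proof
  fix s
  show "phi_formal sc (Poly_Mapping.single (F, x) c) s = sc c (sc (rep F s) x)"
    by (subst phi_formal_eq_sum[of "{(F, x)}"]) auto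
qed

text \<open>Relations in the vector argument vanish at every point. Those in the function argument
  vanish only almost everywhere, since the representative chosen for a sum or multiple of classes
  agrees with the sum or multiple of chosen representatives up to a null set.\<close>

lemma AE_phi_formal_relation:
  assumes p: "p \<ge> 1"
    and a: "a \<in> bilinearity_relations
      (scalar_Lp M p :: ('k, ('s \<Rightarrow> 'k) set) nspace) (space_of sc)"
  shows "AE s in M. phi_formal sc a s = 0"
  using a unfolding bilinearity_relations_def Let_def
proof (elim UnE CollectE exE conjE)
  fix F G :: "('s \<Rightarrow> 'k) set" and x
  assume a: "a = Poly_Mapping.single (add (scalar_Lp M p) F G, x) 1 -
      Poly_Mapping.single (F, x) 1 - Poly_Mapping.single (G, x) 1"
    and FG: "F \<in> carr (scalar_Lp M p)" "G \<in> carr (scalar_Lp M p)"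
  have "add (scalar_Lp M p) F G = Lp_eq M p `` {\<lambda>s. rep F s + rep G s}"
    using scalar.Lp_add[OF p rep_class(1)[OF FG(1)] rep_class(1)[OF FG(2)]]
    by (simp only: rep_class(2)[OF FG(1)] rep_class(2)[OF FG(2)])
  then have "AE s in M. rep (add (scalar_Lp M p) F G) s = rep F s + rep G s"
    using AE_rep_class[OF Lp_fun_add[OF p rep_class(1)[OF FG(1)] rep_class(1)[OF FG(2)]]]
    by simp
  then show ?thesis
    by eventually_elim (simp add: a phi_formal_diff phi_formal_single scale_left_distrib)
next
  fix F :: "('s \<Rightarrow> 'k) set" and x c
  assume a: "a = Poly_Mapping.single (smul (scalar_Lp M p) c F, x) 1 -
      Poly_Mapping.single (F, x) c"
    and F: "F \<in> carr (scalar_Lp M p)"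
  have "smul (scalar_Lp M p) c F = Lp_eq M p `` {\<lambda>s. c * rep F s}"
    using scalar.Lp_smul[OF rep_class(1)[OF F]] by (simp only: rep_class(2)[OF F])
  then have "AE s in M. rep (smul (scalar_Lp M p) c F) s = c * rep F s"
    using AE_rep_class[OF scalar.Lp_fun_smul[OF rep_class(1)[OF F]]] by simp
  then show ?thesis
    by eventually_elim (simp add: a phi_formal_diff phi_formal_single)
qed (auto simp: phi_formal_diff phi_formal_single space_of_def scale_right_distrib mult.commute)

text \<open>This is what makes \<open>phi\<close> well defined: vanishing almost everywhere is
  preserved by linear combinations, so it spreads from the relations to their span.\<close>

lemma AE_phi_formal_span:
  assumes p: "p \<ge> 1"
    and "a \<in> formal.span (bilinearity_relations
      (scalar_Lp M p :: ('k, ('s \<Rightarrow> 'k) set) nspace) (space_of sc))"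
  shows "AE s in M. phi_formal sc a s = 0"
  using assms(2)
proof (induction rule: formal.span_induct_alt)
  case base
  show ?case by (simp add: phi_formal_def)
next
  case (step c a b)
  have "AE s in M. phi_formal sc a s = 0"
    by (rule AE_phi_formal_relation[OF p step(1)])
  then show ?case
    using step(2) by eventually_elim (simp add: phi_formal_add phi_formal_smul)
qed

lemma phi_formal_Lp_fun:
  assumes p: "p \<ge> 1"
    and a: "a \<in> carr (formal_space
      (scalar_Lp M p :: ('k, ('s \<Rightarrow> 'k) set) nspace) (space_of sc))"
  shows "phi_formal sc a \<in> Lp_fun M p"
proof -
  have "(\<lambda>s. \<Sum>(F, x)\<in>K. sc (Poly_Mapping.lookup a (F, x)) (sc (rep F s) x)) \<in> Lp_fun M p"
    if "finite K" "K \<subseteq> carr (scalar_Lp M p) \<times> UNIV" for K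
    using that
  proof (induction K)
    case empty
    show ?case by (simp add: Lp_fun_zero)
  next
    case (insert k K)
    obtain F x where k: "k = (F, x)" by (cases k)
    have "F \<in> carr (scalar_Lp M p)" using insert.prems by (simp add: k)
    then have "(\<lambda>s. sc (Poly_Mapping.lookup a (F, x)) (sc (rep F s) x)) \<in> Lp_fun M p"
      by (intro Lp_fun_smul Lp_fun_tensor rep_class(1))
    then show ?case
      using insert Lp_fun_add[OF p] by (simp add: k)
  qed
  from this[of "Poly_Mapping.keys a"] show ?thesis
    using a unfolding phi_formal_def by (simp add: formal_space_simps space_of_def)
qed

section \<open>The \<open>\<Delta>\<close> norm evaluated on tensor classes\<close>

abbreviation class_of ::
  "'s measure \<Rightarrow> real \<Rightarrow> (('s \<Rightarrow> 'k) set \<times> 'x \<Rightarrow>\<^sub>0 'k) \<Rightarrow> (('s \<Rightarrow> 'k) set \<times> 'x \<Rightarrow>\<^sub>0 'k) set" where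
  "class_of M p a \<equiv> tensor_eq (scalar_Lp M p) (space_of sc) `` {a}"

abbreviation formal_elems ::
  "'s measure \<Rightarrow> real \<Rightarrow> (('s \<Rightarrow> 'k) set \<times> 'x \<Rightarrow>\<^sub>0 'k) set" where
  "formal_elems M p \<equiv> carr (formal_space (scalar_Lp M p) (space_of sc))"

lemma Delta_simps:
  "carr (Delta_tensor_space sc M p) =
    formal_elems M p // tensor_eq (scalar_Lp M p) (space_of sc)"
  "add (Delta_tensor_space sc M p) = add (quot (formal_space (scalar_Lp M p) (space_of sc))
    (tensor_eq (scalar_Lp M p) (space_of sc)))"
  "smul (Delta_tensor_space sc M p) = smul (quot (formal_space (scalar_Lp M p) (space_of sc))
    (tensor_eq (scalar_Lp M p) (space_of sc)))"
  "nrm (Delta_tensor_space sc M p) = (\<lambda>A. nrm (Lp sc M p) (phi sc M p A))"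
  by (simp_all add: Delta_tensor_space_def with_norm_def tensor_space_def)
    (simp add: quot_def)

lemma Delta_add:
  assumes "a \<in> formal_elems M p" "b \<in> formal_elems M p"
  shows "add (Delta_tensor_space sc M p) (class_of M p a) (class_of M p b) = class_of M p (a + b)"
  using add_quot[OF equiv_tensor_eq, of "scalar_Lp M p" "space_of sc" a b] assms
  by (simp only: Delta_simps formal_space_simps(2,3) tensor_eq_add)

lemma Delta_smul:
  assumes "a \<in> formal_elems M p"
  shows "smul (Delta_tensor_space sc M p) c (class_of M p a) = class_of M p (formal_smul c a)"
  using smul_quot[OF equiv_tensor_eq, of "scalar_Lp M p" "space_of sc" c a] assms
  by (simp only: Delta_simps formal_space_simps(2,3) tensor_eq_smul)

text \<open>Members of one tensor class have images that agree almost everywhere, so the union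
  defining \<open>phi\<close> is a single \<open>L^p\<close> class and the norm can be read off from
  any representative.\<close>

lemma Delta_nrm:
  assumes p: "p \<ge> 1" and a: "a \<in> formal_elems M p"
  shows "nrm (Delta_tensor_space sc M p) (class_of M p a) = Lp_fun_norm M p (phi_formal sc a)"
proof -
  have "Lp_eq M p `` {phi_formal sc b} = Lp_eq M p `` {phi_formal sc a}"
    if "b \<in> class_of M p a" for b
  proof -
    from that have b: "b \<in> formal_elems M p"
      and "a - b \<in> formal.span (bilinearity_relations (scalar_Lp M p) (space_of sc))"
      by (auto simp: tensor_eq_iff)
    then have "AE s in M. phi_formal sc (a - b) s = 0"
      by (intro AE_phi_formal_span[OF p])
    then have "AE s in M. phi_formal sc b s = phi_formal sc a s"
      by eventually_elim (simp add: phi_formal_diff)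
    then show ?thesis
      using Lp_class_eq_iff phi_formal_Lp_fun[OF p] a b by blast
  qed
  moreover have "a \<in> class_of M p a"
    by (rule equiv_class_self[OF equiv_tensor_eq a])
  ultimately have "phi sc M p (class_of M p a) = Lp_eq M p `` {phi_formal sc a}"
    unfolding phi_def by blast
  then show ?thesis
    by (simp add: Delta_simps Lp_nrm phi_formal_Lp_fun[OF p a])
qed

lemma Delta_ndist:
  assumes p: "p \<ge> 1" and "a \<in> formal_elems M p" "b \<in> formal_elems M p"
  shows "ndist (Delta_tensor_space sc M p) (class_of M p a) (class_of M p b) =
    Lp_fun_norm M p (\<lambda>s. phi_formal sc a s - phi_formal sc b s)"
  unfolding ndist_def
  by (simp only: Delta_smul Delta_add Delta_nrm assms formal_space_smul formal_space_add
      phi_formal_add phi_formal_smul) simp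

lemma Delta_cases:
  assumes "A \<in> carr (Delta_tensor_space sc M p)"
  obtains a where "a \<in> formal_elems M p" "A = class_of M p a"
  using assms unfolding Delta_simps by (auto elim: quotientE)

lemma class_of_in_Delta:
  "a \<in> formal_elems M p \<Longrightarrow> class_of M p a \<in> carr (Delta_tensor_space sc M p)"
  unfolding Delta_simps by (rule quotientI)

text \<open>Linearity of \<open>phi_formal\<close> turns distances into \<open>L^p\<close> norms of
  differences. The triangle law, \<open>dist_add\<close> and \<open>nrm_le\<close> are then
  Minkowski's inequality for \<open>(a - b) + (b - c)\<close>, \<open>(a - a') + (b - b')\<close>
  and \<open>b + (a - b)\<close>.\<close>

lemma normed_ops_Delta:
  assumes p: "p \<ge> 1"
  shows "normed_ops (Delta_tensor_space sc M p)"
proof -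
  note simps = Delta_add Delta_smul Delta_nrm[OF p] Delta_ndist[OF p] class_of_in_Delta
    formal_space_add formal_space_smul
  note Lp = phi_formal_Lp_fun[OF p] Lp_fun_diff[OF p]
  show ?thesis
  proof (unfold_locales, goal_cases)
    case (1 A B)
    then show ?case by (elim Delta_cases) (simp add: simps)
  next
    case (2 A c)
    then show ?case by (elim Delta_cases) (simp add: simps)
  next
    case (3 A B)
    then show ?case by (elim Delta_cases) (simp add: simps Lp_fun_norm_nonneg)
  next
    case (4 A)
    then show ?case by (elim Delta_cases) (simp add: simps, simp add: Lp_fun_norm_def)
  next
    case (5 A B)
    then show ?case
      by (elim Delta_cases) (simp add: simps, simp add: Lp_fun_norm_def norm_minus_commute)
  next
    case (6 A B C)
    then show ?case
    proof (elim Delta_cases)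
      fix a b c
      assume abc: "a \<in> formal_elems M p" "b \<in> formal_elems M p" "c \<in> formal_elems M p"
        "A = class_of M p a" "B = class_of M p b" "C = class_of M p c"
      then show "ndist (Delta_tensor_space sc M p) A C
          \<le> ndist (Delta_tensor_space sc M p) A B + ndist (Delta_tensor_space sc M p) B C"
        using Lp_fun_norm_triangle[OF p Lp(2)[OF Lp(1)[OF abc(1)] Lp(1)[OF abc(2)]]
            Lp(2)[OF Lp(1)[OF abc(2)] Lp(1)[OF abc(3)]]]
        by (simp add: simps)
    qed
  next
    case (7 A B A' B')
    then show ?case
    proof (elim Delta_cases)
      fix a b a' b'
      assume ab: "a \<in> formal_elems M p" "b \<in> formal_elems M p"
        "a' \<in> formal_elems M p" "b' \<in> formal_elems M p"
        "A = class_of M p a" "B = class_of M p b" "A' = class_of M p a'" "B' = class_of M p b'"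
      then show "ndist (Delta_tensor_space sc M p) (add (Delta_tensor_space sc M p) A B)
          (add (Delta_tensor_space sc M p) A' B')
          \<le> ndist (Delta_tensor_space sc M p) A A' + ndist (Delta_tensor_space sc M p) B B'"
        using Lp_fun_norm_triangle[OF p Lp(2)[OF Lp(1)[OF ab(1)] Lp(1)[OF ab(3)]]
            Lp(2)[OF Lp(1)[OF ab(2)] Lp(1)[OF ab(4)]]]
        by (simp add: simps phi_formal_add algebra_simps)
    qed
  next
    case (8 A B c)
    then show ?case
      using p Lp_fun_norm_smul[of p M c]
      by (elim Delta_cases) (simp add: simps phi_formal_smul flip: scale_right_diff_distrib)
  next
    case (9 A B)
    then show ?case
    proof (elim Delta_cases)
      fix a b
      assume ab: "a \<in> formal_elems M p" "b \<in> formal_elems M p"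
        "A = class_of M p a" "B = class_of M p b"
      then show "nrm (Delta_tensor_space sc M p) A
          \<le> nrm (Delta_tensor_space sc M p) B + ndist (Delta_tensor_space sc M p) A B"
        using Lp_fun_norm_triangle[OF p Lp(1)[OF ab(2)] Lp(2)[OF Lp(1)[OF ab(1)] Lp(1)[OF ab(2)]]]
        by (simp add: simps)
    qed
  qed
qed

text \<open>Strips off the completion and the tensor product, leaving inequalities between
  \<open>L^p\<close> norms of concrete functions.\<close>

lemma BJ_orthogonal_Delta:
  assumes p: "p \<ge> 1" and F: "F \<in> carr (scalar_Lp M p)" and G: "G \<in> carr (scalar_Lp M p)"
  shows "BJ_orthogonal (Delta_completion sc M p) (Delta_tensor sc M p F x) (Delta_tensor sc M p G y)
    \<longleftrightarrow> (\<forall>c. Lp_fun_norm M p (\<lambda>s. sc (rep F s) x)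
      \<le> Lp_fun_norm M p (\<lambda>s. sc (rep F s) x + sc c (sc (rep G s) y)))"
proof -
  have mem: "Poly_Mapping.single (F, x) 1 \<in> formal_elems M p"
    "Poly_Mapping.single (G, y) 1 \<in> formal_elems M p"
    using F G by (simp_all add: formal_space_single space_of_def)
  have "BJ_orthogonal (Delta_completion sc M p) (Delta_tensor sc M p F x) (Delta_tensor sc M p G y)
    \<longleftrightarrow> BJ_orthogonal (Delta_tensor_space sc M p) (class_of M p (Poly_Mapping.single (F, x) 1))
      (class_of M p (Poly_Mapping.single (G, y) 1))"
    unfolding Delta_completion_def Delta_tensor_def tensor_def
    by (rule normed_ops.BJ_orthogonal_completion[OF normed_ops_Delta[OF p]])
      (rule class_of_in_Delta, rule mem)+
  also have "\<dots> \<longleftrightarrow> (\<forall>c. Lp_fun_norm M p (\<lambda>s. sc (rep F s) x)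
      \<le> Lp_fun_norm M p (\<lambda>s. sc (rep F s) x + sc c (sc (rep G s) y)))"
    unfolding BJ_orthogonal_def
    by (simp only: Delta_add Delta_smul Delta_nrm[OF p] mem formal_space_smul formal_space_add
        phi_formal_add phi_formal_smul phi_formal_single scale_one)
  finally show ?thesis .
qed

end

section \<open>Orthogonality of elementary tensors\<close>

lemma Lp_fun_norm_mono:
  assumes "p > 0" "f \<in> Lp_fun M p" "g \<in> Lp_fun M p" "\<And>s. norm (f s) \<le> norm (g s)"
  shows "Lp_fun_norm M p f \<le> Lp_fun_norm M p g"
  unfolding Lp_fun_norm_def
  using assms by (intro powr_mono2 integral_mono) (simp_all add: Lp_fun_def powr_mono2)

text \<open>Mean value theorem: the derivative at an intermediate point is at most its value at
  \<open>m\<close>, as \<open>p - 1 > 0\<close>.\<close>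

lemma abs_powr_diff_le:
  fixes a b m p :: real
  assumes p: "1 < p" and "0 \<le> a" "a \<le> m" "0 \<le> b" "b \<le> m"
  shows "\<bar>a powr p - b powr p\<bar> \<le> p * m powr (p - 1) * \<bar>a - b\<bar>"
proof -
  have less: "\<bar>v powr p - u powr p\<bar> \<le> p * m powr (p - 1) * \<bar>v - u\<bar>"
    if uv: "0 \<le> u" "u < v" "v \<le> m" for u v
  proof -
    \<comment> \<open>The left end may be 0, so differentiability is shown only for
      \<open>u < x\<close>, where \<open>x\<close> is positive; the mean value theorem asks no
      more.\<close>
    have "continuous_on {u..v} (\<lambda>x. x powr p)"
      using p uv by (intro continuous_on_powr' continuous_intros) auto
    moreover have "((\<lambda>x. x powr p) has_derivative (*) (p * x powr (p - 1))) (at x)" if "u < x" for x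
      using that uv has_real_derivative_powr[of x p] by (simp add: has_field_derivative_def)
    ultimately obtain \<xi> where xi: "u < \<xi>" "\<xi> < v"
      and eq: "v powr p - u powr p = p * \<xi> powr (p - 1) * (v - u)"
      using mvt[OF uv(2), of "\<lambda>x. x powr p" "\<lambda>x. (*) (p * x powr (p - 1))"] by metis
    have "p * \<xi> powr (p - 1) * (v - u) \<le> p * m powr (p - 1) * (v - u)"
      using p uv xi by (intro mult_right_mono mult_left_mono powr_mono2) auto
    moreover have "0 \<le> p * \<xi> powr (p - 1) * (v - u)"
      using p uv by simp
    ultimately show ?thesis using uv eq by simp
  qed
  consider "a < b" | "a = b" | "b < a" by linarith
  then show ?thesis
    using less[of a b] less[of b a] assms by cases (simp_all add: abs_minus_commute)
qed

lemma has_real_derivative_zero_sequentially: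
  fixes t :: "nat \<Rightarrow> real"
  assumes "(F has_real_derivative 0) (at 0)" "F 0 = 0" "t \<longlonglongrightarrow> 0" "\<And>n. t n \<noteq> 0"
  shows "(\<lambda>n. F (t n) / t n) \<longlonglongrightarrow> 0"
proof -
  have "((\<lambda>h. F h / h) \<longlongrightarrow> 0) (at 0)"
    using assms(1,2) by (simp add: DERIV_def)
  moreover have "filterlim t (at 0) sequentially"
    using assms(3,4) by (simp add: filterlim_at)
  ultimately show ?thesis by (rule filterlim_compose)
qed

context normed_scaling
begin

interpretation scalar: normed_scaling "(*) :: 'k \<Rightarrow> 'k \<Rightarrow> 'k"
  by (rule normed_scaling_times)

text \<open>By contradiction, along \<open>t n = 1 / (n + 1)\<close>. Orthogonality bounds the
  integral of \<open>a n s powr p\<close> from below, convexity bounds that of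
  \<open>b n s powr p\<close> from above, and the integral of the difference quotient
  \<open>D n\<close> tends to 0. In the limit \<open>f + c g\<close> could not have a smaller norm
  than \<open>f\<close>, against \<open>less\<close>.\<close>

lemma Lp_fun_norm_less_tensor:
  fixes f g :: "'s \<Rightarrow> 'k"
  assumes p: "1 < p" and f: "f \<in> Lp_fun M p" and g: "g \<in> Lp_fun M p"
    and x: "x \<noteq> 0" and k: "k \<noteq> 0"
    and smooth: "\<And>w. ((\<lambda>t. norm (x + sc (of_real t * w) y) - norm x * norm (1 + of_real t * w * k))
      has_real_derivative 0) (at 0)"
    and less: "Lp_fun_norm M p (\<lambda>s. f s + c * g s) < Lp_fun_norm M p f"
  shows "\<exists>d. Lp_fun_norm M p (\<lambda>s. sc (f s) x + sc d (sc (g s) y))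
    < Lp_fun_norm M p (\<lambda>s. sc (f s) x)"
proof (rule ccontr)
  assume "\<not> ?thesis"
  then have orth: "Lp_fun_norm M p (\<lambda>s. sc (f s) x)
      \<le> Lp_fun_norm M p (\<lambda>s. sc (f s) x + sc d (sc (g s) y))" for d
    by (simp add: not_less)
  define t where "t n = inverse (real (Suc n))" for n
  have t: "0 < t n" "t n \<le> 1" "t n \<noteq> 0" for n
    by (simp_all add: t_def field_simps)
  have t0: "t \<longlonglongrightarrow> 0"
    unfolding t_def by (rule LIMSEQ_inverse_real_of_nat)
  \<comment> \<open>Then \<open>d * k = c\<close>, so \<open>smooth\<close> pairs the tensor
    perturbation in \<open>a\<close> with the scalar perturbation in \<open>b\<close>.\<close>
  define d where "d = c / k"
  define a where "a n s = norm (sc (f s) x + sc (of_real (t n) * d) (sc (g s) y))" for n s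
  define b where "b n s = norm x * norm (f s + of_real (t n) * c * g s)" for n s
  define D where "D n s = (a n s powr p - b n s powr p) / t n" for n s
  \<comment> \<open>The three coefficients in the bounds \<open>a_f\<close> and \<open>b_f\<close>
    add up to \<open>K\<close>, so that \<open>m\<close> dominates \<open>a n\<close>,
    \<open>b n\<close> and \<open>\<bar>a n s - b n s\<bar> / t n\<close> uniformly in
    \<open>n\<close>.\<close>
  define K where "K = norm x + norm x * norm c + norm d * norm y"
  define m where "m s = K * (norm (f s) + norm (g s))" for s
  have K: "0 \<le> K" by (simp add: K_def)
  have m: "0 \<le> m s" for s using K by (simp add: m_def)
  let ?I = "\<lambda>h :: 's \<Rightarrow> 'k. LINT s|M. norm (h s) powr p"

  have Lp_a: "(\<lambda>s. sc (f s) x + sc (of_real (t n) * d) (sc (g s) y)) \<in> Lp_fun M p" for n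
    using p by (intro Lp_fun_add Lp_fun_smul Lp_fun_tensor f g) simp
  have Lp_fg: "(\<lambda>s. f s + e * g s) \<in> Lp_fun M p" for e
    using p by (intro Lp_fun_add scalar.Lp_fun_smul f g) simp
  have int_a: "integrable M (\<lambda>s. a n s powr p)" for n
    using Lp_a[of n] by (simp add: Lp_fun_def a_def)
  have int_b: "integrable M (\<lambda>s. b n s powr p)" for n
    using Lp_fg[of "of_real (t n) * c"] by (simp add: Lp_fun_def b_def powr_mult)
  have int_f: "integrable M (\<lambda>s. norm (f s) powr p)"
    and int_g: "integrable M (\<lambda>s. norm (g s) powr p)"
    and int_fc: "integrable M (\<lambda>s. norm (f s + c * g s) powr p)"
    using f g Lp_fg[of c] by (simp_all add: Lp_fun_def)

  have a_f: "\<bar>a n s - norm x * norm (f s)\<bar> \<le> t n * (norm d * norm y * norm (g s))" for n s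
    using norm_triangle_ineq3[of "sc (f s) x + sc (of_real (t n) * d) (sc (g s) y)" "sc (f s) x"] t[of n]
    by (simp add: a_def norm_scale norm_mult algebra_simps)
  have b_f: "\<bar>b n s - norm x * norm (f s)\<bar> \<le> t n * (norm x * norm c * norm (g s))" for n s
  proof -
    have "\<bar>norm (f s + of_real (t n) * c * g s) - norm (f s)\<bar> \<le> t n * norm c * norm (g s)"
      using norm_triangle_ineq3[of "f s + of_real (t n) * c * g s" "f s"] t[of n]
      by (simp add: norm_mult)
    then have "norm x * \<bar>norm (f s + of_real (t n) * c * g s) - norm (f s)\<bar>
        \<le> norm x * (t n * norm c * norm (g s))"
      by (rule mult_left_mono) simp
    moreover have "\<bar>b n s - norm x * norm (f s)\<bar>
        = norm x * \<bar>norm (f s + of_real (t n) * c * g s) - norm (f s)\<bar>"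
      by (simp only: b_def right_diff_distrib[symmetric] abs_mult abs_norm_cancel)
    ultimately show ?thesis by (simp only: ac_simps)
  qed
  have le_m: "norm x * norm (f s) + norm x * norm c * norm (g s) + norm d * norm y * norm (g s)
      \<le> m s" for s
    by (simp add: m_def K_def algebra_simps)
  have t_le: "t n * u \<le> u" if "0 \<le> u" for n u
    using mult_right_mono[OF t(2) that] by simp
  have a_m: "0 \<le> a n s" "a n s \<le> m s" and b_m: "0 \<le> b n s" "b n s \<le> m s" for n s
  proof -
    show "0 \<le> a n s" "0 \<le> b n s" by (simp_all add: a_def b_def)
    have "0 \<le> norm d * norm y * norm (g s)" "0 \<le> norm x * norm c * norm (g s)" by simp_all
    then show "a n s \<le> m s" "b n s \<le> m s"
      using a_f[of n s] b_f[of n s] le_m[of s] t_le[of "norm d * norm y * norm (g s)" n]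
        t_le[of "norm x * norm c * norm (g s)" n] by linarith+
  qed
  have a_b: "\<bar>a n s - b n s\<bar> / t n \<le> m s" for n s
  proof -
    have "\<bar>a n s - b n s\<bar>
        \<le> t n * (norm d * norm y * norm (g s)) + t n * (norm x * norm c * norm (g s))"
      using a_f[of n s] b_f[of n s] by linarith
    also have "\<dots> = t n * (norm d * norm y * norm (g s) + norm x * norm c * norm (g s))"
      by (simp add: distrib_left)
    also have "\<dots> \<le> t n * m s"
    proof (rule mult_left_mono)
      have "0 \<le> norm x * norm (f s)" by simp
      then show "norm d * norm y * norm (g s) + norm x * norm c * norm (g s) \<le> m s"
        using le_m[of s] by linarith
    qed (use t[of n] in simp)
    finally show ?thesis using t[of n] by (simp add: divide_le_eq mult.commute)
  qed
  have D_le: "\<bar>D n s\<bar> \<le> p * m s powr (p - 1) * (\<bar>a n s - b n s\<bar> / t n)" for n s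
    using abs_powr_diff_le[OF p a_m[of n s] b_m[of n s]] t[of n]
    by (simp add: D_def abs_divide divide_right_mono)

  have "(\<lambda>n. LINT s|M. D n s) \<longlonglongrightarrow> (LINT s|M. 0)"
  proof (rule integral_dominated_convergence)
    \<comment> \<open>By \<open>D_le\<close> and \<open>a_b\<close> the quotient is at most
      \<open>p * m s powr (p - 1) * m s = p * m s powr p\<close>; the majorant is this bound after
      \<open>powr_add_le\<close>.\<close>
    show "integrable M (\<lambda>s. p * K powr p * (2 powr p * (norm (f s) powr p + norm (g s) powr p)))"
      using int_f int_g by simp
    show "(\<lambda>s. D n s) \<in> borel_measurable M" for n
      using int_a[of n] int_b[of n] by (simp add: D_def borel_measurable_integrable)
    show "AE s in M. norm (D n s)
        \<le> p * K powr p * (2 powr p * (norm (f s) powr p + norm (g s) powr p))" for n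
    proof (rule AE_I2)
      fix s
      have "norm (D n s) \<le> p * m s powr (p - 1) * (\<bar>a n s - b n s\<bar> / t n)"
        using D_le by simp
      also have "\<dots> \<le> p * m s powr (p - 1) * m s"
        using p by (intro mult_left_mono a_b) simp
      also have "\<dots> = p * m s powr p"
        using powr_mult_base[OF m, of s "p - 1"] by (simp add: ac_simps)
      also have "\<dots> = p * K powr p * (norm (f s) + norm (g s)) powr p"
        using K by (simp add: m_def powr_mult)
      also have "\<dots> \<le> p * K powr p * (2 powr p * (norm (f s) powr p + norm (g s) powr p))"
        using p by (intro mult_left_mono powr_add_le) simp_all
      finally show "norm (D n s)
          \<le> p * K powr p * (2 powr p * (norm (f s) powr p + norm (g s) powr p))" .
    qed
    show "AE s in M. (\<lambda>n. D n s) \<longlonglongrightarrow> 0"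
    proof (rule AE_I2)
      fix s
      show "(\<lambda>n. D n s) \<longlonglongrightarrow> 0"
      \<comment> \<open>Where \<open>f s = 0\<close>, both \<open>a n s\<close> and
        \<open>b n s\<close> are multiples of \<open>t n\<close>, so \<open>D n s\<close> is a
        multiple of \<open>t n powr (p - 1)\<close> and tends to 0 because
        \<open>p > 1\<close>.\<close>
      proof (cases "f s = 0")
        case True
        define u where "u = norm d * norm y * norm (g s)"
        define v where "v = norm x * norm c * norm (g s)"
        have "D n s = t n powr (p - 1) * (u powr p - v powr p)" for n
        proof -
          have "a n s = t n * u" "b n s = t n * v"
            using True t[of n]
            by (simp_all add: a_def b_def u_def v_def norm_scale norm_mult)
          then have "D n s = (t n powr p / t n) * (u powr p - v powr p)"
            using t[of n] by (simp add: D_def powr_mult u_def v_def algebra_simps diff_divide_distrib)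
          moreover have "t n powr p / t n = t n powr (p - 1)"
            using t[of n] by (simp add: powr_diff)
          ultimately show ?thesis by simp
        qed
        moreover have "(\<lambda>n. t n powr (p - 1)) \<longlonglongrightarrow> 0"
          using p t by (intro tendsto_zero_powrI[OF t0 tendsto_const]) (simp_all add: less_imp_le)
        ultimately show ?thesis
          by (simp add: tendsto_mult_left_zero)
      next
        case False
        \<comment> \<open>Where \<open>f s\<close> is nonzero it factors out of both norms, and what
          remains is the function of \<open>smooth\<close> in the direction
          \<open>w\<close>.\<close>
        define w where "w = d * (g s / f s)"
        define F where "F r = norm (x + sc (of_real r * w) y) - norm x * norm (1 + of_real r * w * k)" for r
        have "a n s = norm (f s) * norm (x + sc (of_real (t n) * w) y)" for n
        proof -
          have "sc (f s) x + sc (of_real (t n) * d) (sc (g s) y)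
              = sc (f s) (x + sc (of_real (t n) * w) y)"
            using False by (simp add: w_def scale_right_distrib)
          then show ?thesis by (simp only: a_def norm_scale)
        qed
        moreover have "b n s = norm (f s) * (norm x * norm (1 + of_real (t n) * w * k))" for n
        proof -
          have "f s + of_real (t n) * c * g s = f s * (1 + of_real (t n) * w * k)"
            using False k by (simp add: w_def d_def field_simps)
          then show ?thesis by (simp only: b_def norm_mult ac_simps)
        qed
        ultimately have ab: "a n s - b n s = norm (f s) * F (t n)" for n
          by (simp add: F_def right_diff_distrib)
        have "(\<lambda>n. F (t n) / t n) \<longlonglongrightarrow> 0"
          unfolding F_def by (rule has_real_derivative_zero_sequentially[OF smooth _ t0 t(3)]) simp
        then have "(\<lambda>n. \<bar>F (t n) / t n\<bar>) \<longlonglongrightarrow> 0" by (rule tendsto_rabs_zero)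
        then have lim: "(\<lambda>n. p * m s powr (p - 1) * norm (f s) * \<bar>F (t n) / t n\<bar>) \<longlonglongrightarrow> 0"
          by (rule tendsto_mult_right_zero)
        show ?thesis
        proof (rule Lim_null_comparison[OF always_eventually lim], rule allI)
          fix n
          show "norm (D n s) \<le> p * m s powr (p - 1) * norm (f s) * \<bar>F (t n) / t n\<bar>"
            using D_le[of n s] t[of n] by (simp add: ab abs_mult abs_divide mult.assoc)
        qed
      qed
    qed
  qed simp
  then have lim: "(\<lambda>n. LINT s|M. D n s) \<longlonglongrightarrow> 0" by simp

  \<comment> \<open>Subtracting the estimates \<open>A\<close> and \<open>B\<close> leaves a factor
    \<open>t n\<close>, which cancels against the divisor in \<open>D n\<close>; the lower bound for
    the integral is therefore independent of \<open>n\<close>.\<close>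
  have "norm x powr p * (?I f - ?I (\<lambda>s. f s + c * g s)) \<le> (LINT s|M. D n s)" for n
  proof -
    have "norm x powr p * ?I f = (LINT s|M. norm (sc (f s) x) powr p)"
      by (simp add: norm_scale powr_mult mult.commute)
    also have "\<dots> \<le> (LINT s|M. a n s powr p)"
      using orth[of "of_real (t n) * d"] p by (simp add: Lp_fun_norm_le_iff a_def)
    finally have A: "norm x powr p * ?I f \<le> (LINT s|M. a n s powr p)" .
    have "(LINT s|M. b n s powr p) \<le> (LINT s|M. norm x powr p *
        ((1 - t n) * norm (f s) powr p + t n * norm (f s + c * g s) powr p))"
    proof (rule integral_mono[OF int_b])
      show "integrable M (\<lambda>s. norm x powr p *
          ((1 - t n) * norm (f s) powr p + t n * norm (f s + c * g s) powr p))"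
        using int_f int_fc by simp
      fix s
      \<comment> \<open>A convex combination of \<open>f s\<close> and \<open>f s + c * g s\<close>
        with weight \<open>t n\<close>, which lies in the unit interval.\<close>
      have "f s + of_real (t n) * c * g s
          = of_real (1 - t n) * f s + of_real (t n) * (f s + c * g s)"
        by (simp add: algebra_simps)
      then have "norm (f s + of_real (t n) * c * g s)
          \<le> norm (of_real (1 - t n) * f s) + norm (of_real (t n) * (f s + c * g s))"
        by (simp only: norm_triangle_ineq)
      also have "\<dots> = (1 - t n) * norm (f s) + t n * norm (f s + c * g s)"
        using t[of n] by (simp only: norm_mult norm_of_real)
      finally have "norm (f s + of_real (t n) * c * g s) powr p
          \<le> ((1 - t n) * norm (f s) + t n * norm (f s + c * g s)) powr p"
        using p by (intro powr_mono2) auto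
      also have "\<dots> \<le> (1 - t n) * norm (f s) powr p + t n * norm (f s + c * g s) powr p"
        using p t[of n] by (intro powr_convex_nonneg) auto
      finally show "b n s powr p \<le> norm x powr p *
          ((1 - t n) * norm (f s) powr p + t n * norm (f s + c * g s) powr p)"
        by (simp add: b_def powr_mult mult_left_mono)
    qed
    also have "\<dots> = norm x powr p * ((1 - t n) * ?I f + t n * ?I (\<lambda>s. f s + c * g s))"
      using int_f int_fc by simp
    finally have B: "(LINT s|M. b n s powr p)
        \<le> norm x powr p * ((1 - t n) * ?I f + t n * ?I (\<lambda>s. f s + c * g s))" .
    have "t n * (norm x powr p * (?I f - ?I (\<lambda>s. f s + c * g s)))
        \<le> (LINT s|M. a n s powr p) - (LINT s|M. b n s powr p)"
      using A B by (simp add: algebra_simps)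
    moreover have "(LINT s|M. D n s) = ((LINT s|M. a n s powr p) - (LINT s|M. b n s powr p)) / t n"
      using int_a[of n] int_b[of n] by (simp add: D_def)
    ultimately show ?thesis
      using t[of n] by (simp add: le_divide_eq mult.commute)
  qed
  then have "norm x powr p * (?I f - ?I (\<lambda>s. f s + c * g s)) \<le> 0"
    by (intro LIMSEQ_le_const[OF lim]) auto
  moreover have "?I (\<lambda>s. f s + c * g s) < ?I f"
    using less p by (simp add: Lp_fun_norm_le_iff flip: not_le)
  ultimately show False
    using x by (simp add: mult_le_0_iff)
qed

text \<open>The scalar \<open>k\<close> links the two factors: \<open>support\<close> shows that
  orthogonality of \<open>f\<close> and \<open>g\<close> suffices, and \<open>smooth\<close> enters
  in the converse.\<close>

lemma BJ_orthogonal_tensor_iff: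
  fixes f g :: "'s \<Rightarrow> 'k"
  assumes p: "1 < p" and f: "f \<in> Lp_fun M p" and g: "g \<in> Lp_fun M p"
    and support: "\<And>a b. norm x * norm (a + b * k) \<le> norm (sc a x + sc b y)"
    and smooth: "\<And>w. x \<noteq> 0 \<Longrightarrow>
      ((\<lambda>t. norm (x + sc (of_real t * w) y) - norm x * norm (1 + of_real t * w * k))
      has_real_derivative 0) (at 0)"
  shows "(\<forall>c. Lp_fun_norm M p (\<lambda>s. sc (f s) x)
      \<le> Lp_fun_norm M p (\<lambda>s. sc (f s) x + sc c (sc (g s) y))) \<longleftrightarrow>
    (\<forall>c. Lp_fun_norm M p f \<le> Lp_fun_norm M p (\<lambda>s. f s + c * g s)) \<or>
    (\<forall>c. norm x \<le> norm (x + sc c y))"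
    (is "?T \<longleftrightarrow> ?F \<or> ?X")
proof
  have p0: "p > 0" and p1: "p \<ge> 1" using p by simp_all
  note Lp = Lp_fun_add[OF p1] Lp_fun_tensor scalar.Lp_fun_smul Lp_fun_smul f g
  show "?F \<or> ?X" if T: ?T
  proof (rule ccontr)
    assume "\<not> ?thesis"
    then obtain c where c: "Lp_fun_norm M p (\<lambda>s. f s + c * g s) < Lp_fun_norm M p f"
      and X: "\<not> ?X" by (auto simp: not_le)
    \<comment> \<open>The vector 0 is orthogonal to everything, and for \<open>k = 0\<close> the
      inequality \<open>support\<close> at \<open>a = 1\<close> is \<open>?X\<close> itself.\<close>
    have x: "x \<noteq> 0" using X by auto
    have k: "k \<noteq> 0" using X support[of 1] by auto
    show False
      using Lp_fun_norm_less_tensor[OF p f g x k smooth[OF x] c] T by (auto simp: not_less[symmetric])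
  qed
  show ?T if "?F \<or> ?X"
    using that
  proof
    assume F: ?F
    show ?T
    proof
      fix c
      have "Lp_fun_norm M p (\<lambda>s. sc (h s) x) = norm x * Lp_fun_norm M p h" for h
        using p0 by (simp add: Lp_fun_norm_def norm_scale powr_mult powr_powr mult.commute)
      \<comment> \<open>Scalar orthogonality is used at the coefficient \<open>c * k\<close>, the
        one that \<open>support\<close> produces for \<open>b = c * g s\<close>.\<close>
      then have "Lp_fun_norm M p (\<lambda>s. sc (f s) x)
          \<le> Lp_fun_norm M p (\<lambda>s. sc (f s + (c * k) * g s) x)"
        using F by (simp add: mult_left_mono)
      also have "\<dots> \<le> Lp_fun_norm M p (\<lambda>s. sc (f s) x + sc c (sc (g s) y))"
      proof (rule Lp_fun_norm_mono[OF p0])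
        fix s
        show "norm (sc (f s + (c * k) * g s) x) \<le> norm (sc (f s) x + sc c (sc (g s) y))"
          using support[of "f s" "c * g s"] by (simp add: norm_scale ac_simps)
      qed (intro Lp)+
      finally show "Lp_fun_norm M p (\<lambda>s. sc (f s) x)
          \<le> Lp_fun_norm M p (\<lambda>s. sc (f s) x + sc c (sc (g s) y))" .
    qed
  next
    assume X: ?X
    show ?T
    proof (rule allI, rule Lp_fun_norm_mono[OF p0])
      fix c s
      show "norm (sc (f s) x) \<le> norm (sc (f s) x + sc c (sc (g s) y))"
      proof (cases "f s = 0")
        case False
        \<comment> \<open>Factoring out \<open>f s\<close> leaves the orthogonality of
          \<open>x\<close> and \<open>y\<close> at a coefficient depending on \<open>s\<close>; this
          is enough because the estimate is pointwise.\<close>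
        have "sc (f s) x + sc c (sc (g s) y) = sc (f s) (x + sc (c * g s / f s) y)"
          using False by (simp add: scale_right_distrib)
        then show ?thesis
          using X by (simp add: norm_scale mult_left_mono)
      qed simp
    qed (intro Lp)+
  qed
qed

end

section \<open>Smooth norms\<close>

lemma norm_line_has_real_derivative:
  fixes x h :: "'x::real_normed_vector"
  assumes "(norm has_derivative D) (at x)"
  shows "((\<lambda>t. norm (x + t *\<^sub>R h)) has_real_derivative D h) (at 0)"
proof -
  have "((\<lambda>t. x + t *\<^sub>R h) has_derivative (\<lambda>t. t *\<^sub>R h)) (at 0)"
    by (auto intro!: derivative_eq_intros)
  moreover have "(norm has_derivative D) (at (x + 0 *\<^sub>R h))" using assms by simp
  ultimately have "((\<lambda>t. norm (x + t *\<^sub>R h)) has_derivative (\<lambda>t. D (t *\<^sub>R h))) (at 0)"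
    by (rule has_derivative_compose)
  moreover have "(\<lambda>t. D (t *\<^sub>R h)) = (*) (D h)"
    using linear_scale[OF has_derivative_linear[OF assms]] by (auto simp: mult.commute)
  ultimately show ?thesis by (simp add: has_field_derivative_def)
qed

text \<open>The norm is 1-Lipschitz, so its difference quotients in direction \<open>h\<close> are
  bounded by \<open>norm h\<close>, and so is their limit.\<close>

lemma norm_derivative_le:
  fixes x h :: "'x::real_normed_vector"
  assumes "(norm has_derivative D) (at x)"
  shows "\<bar>D h\<bar> \<le> norm h"
proof (rule tendsto_upperbound)
  show "((\<lambda>t. \<bar>(norm (x + t *\<^sub>R h) - norm x) / t\<bar>) \<longlongrightarrow> \<bar>D h\<bar>) (at 0)"
    using norm_line_has_real_derivative[OF assms, of h] by (intro tendsto_rabs) (simp add: DERIV_def)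
  show "\<forall>\<^sub>F t in at 0. \<bar>(norm (x + t *\<^sub>R h) - norm x) / t\<bar> \<le> norm h"
  proof (rule eventually_mono[OF eventually_neq_at_within[of 0]])
    fix t :: real assume "t \<noteq> 0"
    then show "\<bar>(norm (x + t *\<^sub>R h) - norm x) / t\<bar> \<le> norm h"
      using norm_triangle_ineq3[of "x + t *\<^sub>R h" x] by (simp add: abs_divide divide_le_eq mult.commute)
  qed
qed simp

text \<open>The derivative of a Euclidean norm at 1 is the inner product with 1: the identity for
  real scalars and, in the next lemma, the real part for complex ones.\<close>

lemma has_real_derivative_abs_one_add: "((\<lambda>t. \<bar>1 + t * u\<bar>) has_real_derivative u) (at 0)"
proof -
  have "(norm has_derivative (\<lambda>h. h \<bullet> sgn (1::real))) (at 1)"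
    by (rule has_derivative_norm) simp
  from norm_line_has_real_derivative[OF this, of u] show ?thesis by simp
qed

lemma has_real_derivative_cmod_one_add:
  "((\<lambda>t. cmod (1 + of_real t * u)) has_real_derivative Re u) (at 0)"
proof -
  have "(norm has_derivative (\<lambda>h. h \<bullet> sgn (1::complex))) (at 1)"
    by (rule has_derivative_norm) simp
  from norm_line_has_real_derivative[OF this, of u] show ?thesis
    by (simp add: scaleR_conv_of_real inner_complex_def)
qed

section \<open>The norming functional obtained from the derivative\<close>

context normed_scaling
begin

lemma sc_of_real_mult: "sc (of_real t * w) y = t *\<^sub>R sc w y"
  using scale_of_real[of t "sc w y"] by simp

text \<open>The functional \<open>\<psi>\<close> norms \<open>x\<close> and \<open>\<rho> \<circ> \<psi>\<close> is the derivative of the norm at \<open>x\<close>;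
  \<open>\<rho>\<close> is the real part.\<close>

lemma support_ratio:
  fixes x y :: 'x
  assumes x: "x \<noteq> 0" and D: "(norm has_derivative D) (at x)"
    and \<rho>: "\<And>u :: 'k. ((\<lambda>t. norm (1 + of_real t * u)) has_real_derivative \<rho> u) (at 0)"
    and \<rho>_scale: "\<And>r u. \<rho> (of_real r * u) = r * \<rho> u"
    and add: "\<And>u v. \<psi> (u + v) = \<psi> u + \<psi> v" and smul: "\<And>c v. \<psi> (sc c v) = c * \<psi> v"
    and le: "\<And>v. norm (\<psi> v) \<le> norm v" and self: "\<psi> x = of_real (norm x)"
    and \<rho>_\<psi>: "\<And>v. \<rho> (\<psi> v) = D v"
  defines "k \<equiv> \<psi> y / of_real (norm x)"
  shows "norm x * norm (a + b * k) \<le> norm (sc a x + sc b y)"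
    and "((\<lambda>t. norm (x + sc (of_real t * w) y) - norm x * norm (1 + of_real t * w * k))
      has_real_derivative 0) (at 0)"
proof -
  have k: "of_real (norm x) * k = \<psi> y" using x by (simp add: k_def)
  have "\<psi> (sc a x + sc b y) = of_real (norm x) * (a + b * k)"
    using k by (simp add: add smul self algebra_simps)
  then have "norm x * norm (a + b * k) = norm (\<psi> (sc a x + sc b y))"
    by (simp add: norm_mult)
  then show "norm x * norm (a + b * k) \<le> norm (sc a x + sc b y)"
    using le by simp
  \<comment> \<open>Both functions of \<open>t\<close> turn out to have the derivative
    \<open>D (sc w y)\<close> at 0, so their difference has derivative 0.\<close>
  have "norm x * \<rho> (w * k) = \<rho> (w * (of_real (norm x) * k))"
    using \<rho>_scale[of "norm x" "w * k"] by (simp add: ac_simps)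
  also have "\<dots> = D (sc w y)" by (simp add: k flip: smul \<rho>_\<psi>)
  finally have eq: "norm x * \<rho> (w * k) = D (sc w y)" .
  have "((\<lambda>t. norm (x + sc (of_real t * w) y)) has_real_derivative D (sc w y)) (at 0)"
    using norm_line_has_real_derivative[OF D, of "sc w y"] by (simp only: sc_of_real_mult)
  moreover have "((\<lambda>t. norm x * norm (1 + of_real t * w * k))
      has_real_derivative norm x * \<rho> (w * k)) (at 0)"
    using DERIV_cmult[OF \<rho>[of "w * k"], of "norm x"] by (simp only: mult.assoc)
  ultimately show "((\<lambda>t. norm (x + sc (of_real t * w) y) - norm x * norm (1 + of_real t * w * k))
      has_real_derivative 0) (at 0)"
    using DERIV_diff[of _ "D (sc w y)" 0 UNIV _ "norm x * \<rho> (w * k)"] eq by simp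
qed

text \<open>Along \<open>x + t u x\<close> the norm equals \<open>norm x * norm (1 + t u)\<close>,
  so both sides are the derivative of one function at 0.\<close>

lemma norm_derivative_self:
  assumes D: "(norm has_derivative D) (at x)"
    and \<rho>: "\<And>u :: 'k. ((\<lambda>t. norm (1 + of_real t * u)) has_real_derivative \<rho> u) (at 0)"
  shows "D (sc u x) = norm x * \<rho> u"
proof (rule DERIV_unique)
  show "((\<lambda>t. norm (x + t *\<^sub>R sc u x)) has_real_derivative D (sc u x)) (at 0)"
    by (rule norm_line_has_real_derivative[OF D])
  have "norm x * norm (1 + of_real t * u) = norm (x + t *\<^sub>R sc u x)" for t
  proof -
    have "x + t *\<^sub>R sc u x = sc (1 + of_real t * u) x"
      by (simp only: scale_left_distrib sc_of_real_mult scale_one)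
    then show ?thesis by (simp only: norm_scale mult.commute)
  qed
  then show "((\<lambda>t. norm (x + t *\<^sub>R sc u x)) has_real_derivative norm x * \<rho> u) (at 0)"
    using DERIV_cmult[OF \<rho>[of u], of "norm x"] by simp
qed

end

text \<open>Over the reals \<open>\<rho>\<close> is the identity and \<open>D\<close> itself is the
  norming functional.\<close>

lemma real_support_ratio:
  fixes x y :: "'x::real_normed_vector"
  assumes "norm differentiable (at x)" "x \<noteq> 0"
  obtains k :: real where
    "\<And>a b. norm x * norm (a + b * k) \<le> norm (a *\<^sub>R x + b *\<^sub>R y)"
    "\<And>w. ((\<lambda>t. norm (x + (of_real t * w) *\<^sub>R y) - norm x * norm (1 + of_real t * w * k))
      has_real_derivative 0) (at 0)"
proof -
  interpret normed_scaling "(*\<^sub>R) :: real \<Rightarrow> 'x \<Rightarrow> 'x" by (rule normed_scaling_scaleR)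
  obtain D where D: "(norm has_derivative D) (at x)"
    using assms(1) by (auto simp: differentiable_def)
  have \<rho>: "((\<lambda>t. norm (1 + of_real t * u)) has_real_derivative u) (at 0)" for u :: real
    using has_real_derivative_abs_one_add[of u] by simp
  note lin = has_derivative_linear[OF D]
  note ratio = support_ratio[where y = y, OF assms(2) D \<rho> _ linear_add[OF lin]]
  have "D x = norm x" using norm_derivative_self[OF D \<rho>, of 1] by simp
  then show thesis
    using norm_derivative_le[OF D] linear_scale[OF lin]
    by (intro that[of "D y / of_real (norm x)"] ratio) simp_all
qed

lemma complex_support_ratio:
  fixes x y :: "'x::real_normed_vector" and sc :: "complex \<Rightarrow> 'x \<Rightarrow> 'x"
  assumes "normed_scaling sc" "norm differentiable (at x)" "x \<noteq> 0"
  obtains k :: complex where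
    "\<And>a b. norm x * norm (a + b * k) \<le> norm (sc a x + sc b y)"
    "\<And>w. ((\<lambda>t. norm (x + sc (of_real t * w) y) - norm x * norm (1 + of_real t * w * k))
      has_real_derivative 0) (at 0)"
proof -
  interpret normed_scaling sc by fact
  obtain D where D: "(norm has_derivative D) (at x)"
    using assms(2) by (auto simp: differentiable_def)
  note lin = has_derivative_linear[OF D]
  note \<rho> = has_real_derivative_cmod_one_add
  \<comment> \<open>The complex-linear functional whose real part is the real-linear
    \<open>D\<close>, namely \<open>D v - \<i> * D (sc \<i> v)\<close>.\<close>
  define \<psi> where "\<psi> v = Complex (D v) (- D (sc \<i> v))" for v
  have add: "\<psi> (u + v) = \<psi> u + \<psi> v" for u v
    by (simp add: \<psi>_def complex_eq_iff scale_right_distrib linear_add[OF lin])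
  have smul: "\<psi> (sc c v) = c * \<psi> v" for c v
  proof -
    have split: "sc c u = Re c *\<^sub>R u + Im c *\<^sub>R sc \<i> u" for u
    proof -
      have "c = of_real (Re c) + of_real (Im c) * \<i>" by (simp add: complex_eq_iff)
      then have "sc c u = sc (of_real (Re c) + of_real (Im c) * \<i>) u" by simp
      then show ?thesis by (simp only: scale_left_distrib sc_of_real_mult scale_of_real)
    qed
    have "D (sc \<i> (sc c v)) = D (sc c (sc \<i> v))" by (simp add: mult.commute)
    also have "\<dots> = D (Re c *\<^sub>R sc \<i> v - Im c *\<^sub>R v)"
      by (subst split) simp
    also have "\<dots> = Re c * D (sc \<i> v) - Im c * D v"
      by (simp only: linear_diff[OF lin] linear_scale[OF lin] real_scaleR_def)
    finally have "D (sc \<i> (sc c v)) = Re c * D (sc \<i> v) - Im c * D v" .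
    moreover have "D (sc c v) = Re c * D v + Im c * D (sc \<i> v)"
      by (simp only: split linear_add[OF lin] linear_scale[OF lin] real_scaleR_def)
    ultimately show ?thesis
      by (simp only: \<psi>_def complex_eq_iff) simp
  qed
  have le: "norm (\<psi> v) \<le> norm v" for v
  proof -
    \<comment> \<open>Multiplication by \<open>c\<close> rotates \<open>\<psi> v\<close> to its
      modulus, where \<open>\<psi>\<close> coincides with the real functional \<open>D\<close>. If
      \<open>\<psi> v = 0\<close>, then \<open>sgn\<close> gives \<open>c = 0\<close>, so
      \<open>norm c\<close> is only known to be at most 1.\<close>
    define c where "c = cnj (sgn (\<psi> v))"
    have "cnj (\<psi> v) * \<psi> v = of_real (norm (\<psi> v)) * of_real (norm (\<psi> v))"
      using complex_norm_square[of "\<psi> v"] by (simp add: power2_eq_square mult.commute)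
    then have "c * \<psi> v = of_real (norm (\<psi> v))"
      by (cases "\<psi> v = 0") (simp_all add: c_def sgn_eq)
    then have "norm (\<psi> v) = Re (\<psi> (sc c v))" by (simp add: smul)
    also have "\<dots> = D (sc c v)" by (simp add: \<psi>_def)
    also have "\<dots> \<le> norm (sc c v)" using norm_derivative_le[OF D, of "sc c v"] by simp
    also have "\<dots> \<le> norm v" by (simp add: c_def norm_scale norm_sgn)
    finally show ?thesis .
  qed
  \<comment> \<open>The directions \<open>x\<close> and \<open>\<i> x\<close> give the real and the
    imaginary part, since the real parts of 1 and \<open>\<i>\<close> are 1 and 0.\<close>
  have self: "\<psi> x = of_real (norm x)"
    using norm_derivative_self[OF D \<rho>, of 1] norm_derivative_self[OF D \<rho>, of \<i>]
    by (simp add: \<psi>_def complex_eq_iff)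
  have "Re (\<psi> v) = D v" for v by (simp add: \<psi>_def)
  note ratio = support_ratio[where y = y, OF assms(3) D \<rho> _ add smul le self this]
  show thesis
    by (intro that[of "\<psi> y / of_real (norm x)"] ratio) simp_all
qed

text \<open>The existence of \<open>k\<close> is a hypothesis because its construction is the only
  step where the real and the complex case differ.\<close>

lemma (in normed_scaling) BJ_orthogonal_elementary_tensor:
  fixes F G :: "('s \<Rightarrow> 'k) set" and x y :: 'x
  assumes p: "1 < p" and F: "F \<in> carr (scalar_Lp M p)" and G: "G \<in> carr (scalar_Lp M p)"
    and ratio: "x \<noteq> 0 \<Longrightarrow> \<exists>k. (\<forall>a b. norm x * norm (a + b * k) \<le> norm (sc a x + sc b y)) \<and>
      (\<forall>w. ((\<lambda>t. norm (x + sc (of_real t * w) y) - norm x * norm (1 + of_real t * w * k))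
        has_real_derivative 0) (at 0))"
  shows "BJ_orthogonal (Delta_completion sc M p) (Delta_tensor sc M p F x) (Delta_tensor sc M p G y)
    \<longleftrightarrow> BJ_orthogonal (scalar_Lp M p) F G \<or> BJ_orthogonal (space_of sc) x y"
proof -
  interpret scalar: normed_scaling "(*) :: 'k \<Rightarrow> 'k \<Rightarrow> 'k"
    by (rule normed_scaling_times)
  have p1: "p \<ge> 1" using p by simp
  have scalar_iff: "BJ_orthogonal (scalar_Lp M p) F G \<longleftrightarrow>
      (\<forall>c. Lp_fun_norm M p (rep F) \<le> Lp_fun_norm M p (\<lambda>s. rep F s + c * rep G s))"
    using scalar.BJ_orthogonal_Lp[OF p1 rep_class(1)[OF F] rep_class(1)[OF G]]
    by (simp only: rep_class(2)[OF F] rep_class(2)[OF G])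
  have space_iff: "BJ_orthogonal (space_of sc) x y \<longleftrightarrow> (\<forall>c. norm x \<le> norm (x + sc c y))"
    by (simp add: BJ_orthogonal_def space_of_def)
  obtain k where support: "\<And>a b. norm x * norm (a + b * k) \<le> norm (sc a x + sc b y)"
    and smooth: "\<And>w. x \<noteq> 0 \<Longrightarrow>
      ((\<lambda>t. norm (x + sc (of_real t * w) y) - norm x * norm (1 + of_real t * w * k))
      has_real_derivative 0) (at 0)"
  proof (cases "x = 0")
    case True
    \<comment> \<open>For \<open>x = 0\<close> the support inequality has left side 0 and the
      smoothness condition is vacuous.\<close>
    then show ?thesis by (intro that[of 0]) simp_all
  next
    case False
    then show ?thesis using ratio that by blast
  qed
  show ?thesis
    unfolding BJ_orthogonal_Delta[OF p1 F G] scalar_iff space_iff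
    by (rule BJ_orthogonal_tensor_iff[OF p rep_class(1)[OF F] rep_class(1)[OF G] support])
      (rule smooth)
qed

text \<open>One conjunct for each scalar field: real scaling comes from the type class, while
  complex scaling ranges over all \<open>normed_scaling\<close> structures on the type.\<close>

theorem theorem4p1:
  fixes M :: "'s measure" and p :: real
  assumes "1 < p"
    and "\<forall>x::'x::banach. x \<noteq> 0 \<longrightarrow> norm differentiable (at x)"
  shows
    "(\<forall>f\<in>carr (scalar_Lp M p). \<forall>g\<in>carr (scalar_Lp M p). \<forall>x y :: 'x.
        BJ_orthogonal (Delta_completion ((*\<^sub>R) :: real \<Rightarrow> 'x \<Rightarrow> 'x) M p)
          (Delta_tensor (*\<^sub>R) M p f x) (Delta_tensor (*\<^sub>R) M p g y) \<longleftrightarrow>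
        BJ_orthogonal (scalar_Lp M p) f g \<or> BJ_orthogonal (space_of (*\<^sub>R)) x y)
   \<and> (\<forall>sc :: complex \<Rightarrow> 'x \<Rightarrow> 'x. normed_scaling sc \<longrightarrow>
       (\<forall>f\<in>carr (scalar_Lp M p). \<forall>g\<in>carr (scalar_Lp M p). \<forall>x y :: 'x.
          BJ_orthogonal (Delta_completion sc M p)
            (Delta_tensor sc M p f x) (Delta_tensor sc M p g y) \<longleftrightarrow>
          BJ_orthogonal (scalar_Lp M p) f g \<or> BJ_orthogonal (space_of sc) x y))"
proof (intro conjI ballI allI impI)
  fix f g :: "('s \<Rightarrow> real) set" and x y :: 'x
  assume "f \<in> carr (scalar_Lp M p)" "g \<in> carr (scalar_Lp M p)"
  then show "BJ_orthogonal (Delta_completion ((*\<^sub>R) :: real \<Rightarrow> 'x \<Rightarrow> 'x) M p)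
      (Delta_tensor (*\<^sub>R) M p f x) (Delta_tensor (*\<^sub>R) M p g y) \<longleftrightarrow>
    BJ_orthogonal (scalar_Lp M p) f g \<or> BJ_orthogonal (space_of (*\<^sub>R)) x y"
  proof (rule normed_scaling.BJ_orthogonal_elementary_tensor[OF normed_scaling_scaleR assms(1)])
    assume x: "x \<noteq> 0"
    show "\<exists>k. (\<forall>a b. norm x * norm (a + b * k) \<le> norm (a *\<^sub>R x + b *\<^sub>R y)) \<and>
      (\<forall>w. ((\<lambda>t. norm (x + (of_real t * w) *\<^sub>R y) - norm x * norm (1 + of_real t * w * k))
        has_real_derivative 0) (at 0))"
      by (rule real_support_ratio[OF assms(2)[rule_format, OF x] x, of y]) blast
  qed
next
  fix sc :: "complex \<Rightarrow> 'x \<Rightarrow> 'x" and f g :: "('s \<Rightarrow> complex) set" and x y :: 'x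
  assume sc: "normed_scaling sc"
    and "f \<in> carr (scalar_Lp M p)" "g \<in> carr (scalar_Lp M p)"
  then show "BJ_orthogonal (Delta_completion sc M p)
      (Delta_tensor sc M p f x) (Delta_tensor sc M p g y) \<longleftrightarrow>
    BJ_orthogonal (scalar_Lp M p) f g \<or> BJ_orthogonal (space_of sc) x y"
  proof (intro normed_scaling.BJ_orthogonal_elementary_tensor[OF sc assms(1)])
    assume x: "x \<noteq> 0"
    show "\<exists>k. (\<forall>a b. norm x * norm (a + b * k) \<le> norm (sc a x + sc b y)) \<and>
      (\<forall>w. ((\<lambda>t. norm (x + sc (of_real t * w) y) - norm x * norm (1 + of_real t * w * k))
        has_real_derivative 0) (at 0))"
      by (rule complex_support_ratio[OF sc assms(2)[rule_format, OF x] x, of y]) blast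
  qed
qed

end
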